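(* Let $E$ be the ground set for the uniform matroid $U_n^m$. Then \[ S(U^m_n) = \displaystyle \sum_{\pi} \mathrm{sgn}(\pi)\, U^{|I|}_I \oplus U^{m-|I|}_L, \] where $\pi$ ranges over all ordered set partitions of $E$ that are fixed points of $\iota_<$, and $(I,L)$ is the pair associated to $\pi$.
   Context: Fix a field $k$. Work in the restriction-contraction Hopf algebra $k\widetilde{\mathcal{M}}$ of (isomorphism classes of) matroids in a class $\mathcal{M}$ closed under direct sums and minors containing the uniform matroids (e.g. partition matroids), with product the direct sum $\oplus$, coproduct $\Delta(M) = \sum_{A \subseteq E} M|_A \otimes M/A$, and antipode $S$. $U^m_n$ is the uniform matroid of rank $m$ on an $n$-element set $E$ (independent sets: all subsets of size $\leq m$), and $U^t_X$ denotes the uniform matroid of rank $t$ with ground set $X$. For an ordered set partition $\pi = (B_1,\ldots,B_j)$ of $E$ (nonempty disjoint parts with union $E$), let $k_i = |B_i|$, let $\ell$ be the first index with $k_1 + \cdots + k_\ell \geq m$, and set $I = B_1 \cup \cdots \cup B_{\ell-1}$ and $L = B_\ell$. Define $\mathrm{sgn}(\pi) = -1$ if $\pi$ has an odd number of parts and $+1$ if it has an even number of parts. Fix a total order $<$ on $E$ and define $\iota_<$ on ordered set partitions of $E$ as follows: scan the parts $B_i$ from left to right and perform the first applicable operation. If $k_i > 1$ and ($k_1+\cdots+k_\ell = m$ or $i \neq \ell$), split: replace $B_i$ by the two parts $\{\max B_i\}, B_i \setminus \{\max B_i\}$ (max with respect to $<$). If $k_i = 1$, $i \neq \ell$, there is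 a next part $B_{i+1}$, and the element of $B_i$ is greater than every element of $B_{i+1}$, merge: replace $B_i, B_{i+1}$ by $B_i \cup B_{i+1}$. Otherwise move on to the next part; if no operation applies to any part, $\pi$ is a fixed point of $\iota_<$. This $\iota_<$ is a sign-reversing involution preserving the term associated to $\pi$ in Takeuchi's formula.
   Formalization: The summand gains a third factor U^0 on E−(I∪L), since elements outside I∪L are loops; and ι merges B_i into B_{i+1} only if k_1+…+k_ℓ=m or i+1≠ℓ, as the printed rule is not an involution (m=2, n=3 gives a wrong coefficient). *)

theory Defs
  imports "HOL-Library.Poly_Mapping" "HOL-Library.Disjoint_Sets"
begin

section \<open>Finite matroids\<close>

definition is_matroid :: "'a set \<Rightarrow> 'a set set \<Rightarrow> bool" where
  "is_matroid E F \<longleftrightarrow> finite E \<and> F \<subseteq> Pow E \<and> {} \<in> F \<and>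
     (\<forall>X\<in>F. \<forall>Y. Y \<subseteq> X \<longrightarrow> Y \<in> F) \<and>
     (\<forall>X\<in>F. \<forall>Y\<in>F. card X < card Y \<longrightarrow> (\<exists>y\<in>Y - X. insert y X \<in> F))"

typedef 'a matroid = "{(E :: 'a set, F). is_matroid E F}"
  by (rule exI[of _ "({}, {{}})"]) (auto simp: is_matroid_def)

setup_lifting type_definition_matroid

lift_definition ground :: "'a matroid \<Rightarrow> 'a set" is fst .

lift_definition indeps :: "'a matroid \<Rightarrow> 'a set set" is snd .

lemma is_matroid: "is_matroid (ground M) (indeps M)"
  by transfer auto

lemma finite_ground [simp]: "finite (ground M)"
  using is_matroid[of M] by (simp add: is_matroid_def)

lemma indeps_subset: "X \<in> indeps M \<Longrightarrow> X \<subseteq> ground M"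
  using is_matroid[of M] by (auto simp: is_matroid_def)

lemma indeps_finite: "X \<in> indeps M \<Longrightarrow> finite X"
  by (meson finite_ground finite_subset indeps_subset)

lemma indeps_empty [simp]: "{} \<in> indeps M"
  using is_matroid[of M] by (simp add: is_matroid_def)

lemma indeps_mono: "X \<in> indeps M \<Longrightarrow> Y \<subseteq> X \<Longrightarrow> Y \<in> indeps M"
  using is_matroid[of M] by (auto simp: is_matroid_def)

lemma indeps_augment:
  "X \<in> indeps M \<Longrightarrow> Y \<in> indeps M \<Longrightarrow> card X < card Y \<Longrightarrow> \<exists>y\<in>Y - X. insert y X \<in> indeps M"
  using is_matroid[of M] by (auto simp: is_matroid_def)

text \<open>The two components of \<^term>\<open>Abs_matroid (E, F)\<close> are meaningful only if
  \<^term>\<open>is_matroid E F\<close> holds.\<close>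

lemma Abs_matroid_sel:
  assumes "is_matroid E F"
  shows "ground (Abs_matroid (E, F)) = E" "indeps (Abs_matroid (E, F)) = F"
  using assms by (simp_all add: ground.rep_eq indeps.rep_eq Abs_matroid_inverse)

definition uniform_matroid :: "nat \<Rightarrow> 'a set \<Rightarrow> 'a matroid" where
  "uniform_matroid m E = Abs_matroid (E, {X. X \<subseteq> E \<and> card X \<le> m})"

lemma is_matroid_uniform:
  assumes "finite E"
  shows "is_matroid E {X. X \<subseteq> E \<and> card X \<le> m}"
  unfolding is_matroid_def
proof (intro conjI ballI allI impI)
  fix X Y assume X: "X \<in> {X. X \<subseteq> E \<and> card X \<le> m}" and "Y \<subseteq> X"
  moreover from this have "card Y \<le> card X"
    using assms by (auto intro: card_mono finite_subset)
  ultimately show "Y \<in> {X. X \<subseteq> E \<and> card X \<le> m}" by auto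
next
  fix X Y assume X: "X \<in> {X. X \<subseteq> E \<and> card X \<le> m}" and Y: "Y \<in> {X. X \<subseteq> E \<and> card X \<le> m}"
    and less: "card X < card Y"
  have "finite X" using X assms by (auto intro: finite_subset)
  then obtain y where y: "y \<in> Y - X"
    using less card_mono[of X Y] by auto
  have "card (insert y X) = Suc (card X)" using y \<open>finite X\<close> by auto
  then show "\<exists>y\<in>Y - X. insert y X \<in> {X. X \<subseteq> E \<and> card X \<le> m}"
    using X Y less y by (intro bexI[of _ y]) auto
qed (use assms in auto)

lemma uniform_matroid_sel:
  assumes "finite E"
  shows "ground (uniform_matroid m E) = E"
    and "indeps (uniform_matroid m E) = {X. X \<subseteq> E \<and> card X \<le> m}"
  using Abs_matroid_sel[OF is_matroid_uniform[OF assms]] by (simp_all add: uniform_matroid_def)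

definition restriction :: "'a matroid \<Rightarrow> 'a set \<Rightarrow> 'a matroid" where
  "restriction M A = Abs_matroid (ground M \<inter> A, {X \<in> indeps M. X \<subseteq> A})"

lemma restriction_sel:
  shows "ground (restriction M A) = ground M \<inter> A"
    and "indeps (restriction M A) = {X \<in> indeps M. X \<subseteq> A}"
proof -
  have "is_matroid (ground M \<inter> A) {X \<in> indeps M. X \<subseteq> A}"
    unfolding is_matroid_def
  proof (intro conjI ballI allI impI)
    fix X Y assume *: "X \<in> {X \<in> indeps M. X \<subseteq> A}" "Y \<in> {X \<in> indeps M. X \<subseteq> A}" "card X < card Y"
    then obtain y where "y \<in> Y - X" "insert y X \<in> indeps M"
      using indeps_augment[of X M Y] by blast
    then show "\<exists>y\<in>Y - X. insert y X \<in> {X \<in> indeps M. X \<subseteq> A}"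
      using * by (intro bexI[of _ y]) auto
  qed (auto dest: indeps_subset intro: indeps_mono)
  then show "ground (restriction M A) = ground M \<inter> A"
    "indeps (restriction M A) = {X \<in> indeps M. X \<subseteq> A}"
    by (simp_all add: restriction_def Abs_matroid_sel)
qed

definition is_basis :: "'a matroid \<Rightarrow> 'a set \<Rightarrow> bool" where
  "is_basis M B \<longleftrightarrow> B \<in> indeps M \<and> (\<forall>X\<in>indeps M. B \<subseteq> X \<longrightarrow> X = B)"

definition contraction :: "'a matroid \<Rightarrow> 'a set \<Rightarrow> 'a matroid" where
  "contraction M A = Abs_matroid (ground M - A,
     {X. X \<subseteq> ground M - A \<and> (\<exists>B. is_basis (restriction M A) B \<and> X \<union> B \<in> indeps M)})"

lemma is_basis_exists: "\<exists>B. is_basis M B"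
proof -
  have "finite (indeps M)"
    by (rule finite_subset[of _ "Pow (ground M)"]) (auto dest: indeps_subset)
  from finite_has_maximal[OF this] show ?thesis
    using indeps_empty[of M] by (fastforce simp: is_basis_def)
qed

lemma indeps_augment_many:
  assumes "X \<in> indeps M" "Y \<in> indeps M" "card X \<le> card Y"
  shows "\<exists>Z. X \<subseteq> Z \<and> Z \<subseteq> X \<union> Y \<and> Z \<in> indeps M \<and> card Z = card Y"
  using assms
proof (induction "card Y - card X" arbitrary: X)
  case 0
  then show ?case by auto
next
  case (Suc n)
  then have "card X < card Y" by linarith
  then obtain y where y: "y \<in> Y - X" "insert y X \<in> indeps M"
    using indeps_augment[of X M Y] Suc.prems by blast
  have "card (insert y X) = Suc (card X)"
    using y indeps_finite[OF Suc.prems(1)] by auto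
  then have "n = card Y - card (insert y X)" "card (insert y X) \<le> card Y"
    using Suc.hyps(2) by auto
  from Suc.hyps(1)[OF this(1) y(2) Suc.prems(2) this(2)] show ?case
    using y by blast
qed

lemma contraction_basis_change:
  assumes B: "is_basis (restriction M A) B" and B': "is_basis (restriction M A) B'"
    and X: "X \<inter> A = {}" "X \<union> B \<in> indeps M"
  shows "X \<union> B' \<in> indeps M"
proof -
  have fin: "finite X" "finite B" using indeps_finite[OF X(2)] by auto
  have BA: "B \<subseteq> A" "B' \<subseteq> A" "B' \<in> indeps M" "B \<in> indeps M"
    using B B' by (auto simp: is_basis_def restriction_sel)
  have "card B' \<le> card B"
  proof (rule ccontr)
    assume "\<not> ?thesis"
    then obtain y where "y \<in> B' - B" "insert y B \<in> indeps M"
      using indeps_augment[of B M B'] BA by auto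
    then show False using B BA by (auto simp: is_basis_def restriction_sel)
  qed
  then have le: "card B' \<le> card (X \<union> B)"
    using fin by (meson card_mono finite_UnI le_trans sup_ge2)
  obtain Z where Z: "B' \<subseteq> Z" "Z \<subseteq> B' \<union> (X \<union> B)" "Z \<in> indeps M" "card Z = card (X \<union> B)"
    using indeps_augment_many[OF BA(3) X(2) le] by blast
  have "Z \<inter> A \<in> indeps M" by (rule indeps_mono[OF Z(3)]) auto
  then have ZA: "Z \<inter> A = B'" using B' BA Z(1) by (auto simp: is_basis_def restriction_sel)
  have XB: "X \<inter> B = {}" using X(1) BA(1) by blast
  have finB': "finite B'" using BA(3) indeps_finite by auto
  have "card (Z - A) = card Z - card B'"
    using ZA card_Diff_subset_Int[of Z A] finB' by auto
  also have "\<dots> \<ge> card X"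
    using \<open>card B' \<le> card B\<close> Z(4) card_Un_disjoint[of X B] fin XB by simp
  finally have "card X \<le> card (Z - A)" .
  moreover have "Z - A \<subseteq> X" using Z(2) BA by auto
  ultimately have "Z - A = X" using fin(1) by (meson card_seteq)
  then have "X \<union> B' = Z" using ZA by auto
  then show ?thesis using Z(3) by simp
qed

lemma contraction_sel:
  shows "ground (contraction M A) = ground M - A"
    and "indeps (contraction M A) =
      {X. X \<subseteq> ground M - A \<and> (\<exists>B. is_basis (restriction M A) B \<and> X \<union> B \<in> indeps M)}"
proof -
  let ?F = "{X. X \<subseteq> ground M - A \<and> (\<exists>B. is_basis (restriction M A) B \<and> X \<union> B \<in> indeps M)}"
  have "is_matroid (ground M - A) ?F"
    unfolding is_matroid_def
  proof (intro conjI ballI allI impI)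
    obtain B where "is_basis (restriction M A) B" using is_basis_exists by blast
    then show "{} \<in> ?F" by (auto simp: is_basis_def restriction_sel)
  next
    fix X Y assume X: "X \<in> ?F" and YX: "Y \<subseteq> X"
    then obtain B where B: "is_basis (restriction M A) B" "X \<union> B \<in> indeps M" by auto
    have "Y \<union> B \<in> indeps M" by (rule indeps_mono[OF B(2)]) (use YX in auto)
    then show "Y \<in> ?F" using X YX B by auto
  next
    fix X Y assume X: "X \<in> ?F" and Y: "Y \<in> ?F" and less: "card X < card Y"
    obtain B where B: "is_basis (restriction M A) B" "X \<union> B \<in> indeps M" using X by auto
    obtain B' where "is_basis (restriction M A) B'" "Y \<union> B' \<in> indeps M" using Y by auto
    then have YB: "Y \<union> B \<in> indeps M"
      using contraction_basis_change[of M A B' B Y] B(1) Y by auto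
    have BA: "B \<subseteq> A" using B by (auto simp: is_basis_def restriction_sel)
    have "card (X \<union> B) = card X + card B"
      by (rule card_Un_disjoint) (use X BA indeps_finite[OF B(2)] in auto)
    moreover have "card (Y \<union> B) = card Y + card B"
      by (rule card_Un_disjoint) (use Y BA indeps_finite[OF YB] in auto)
    ultimately obtain y where y: "y \<in> (Y \<union> B) - (X \<union> B)" "insert y (X \<union> B) \<in> indeps M"
      using indeps_augment[OF B(2) YB] less by auto
    then have "insert y X \<in> ?F" using X Y B(1) by auto
    then show "\<exists>y\<in>Y - X. insert y X \<in> ?F" using y by blast
  qed auto
  then show "ground (contraction M A) = ground M - A" "indeps (contraction M A) = ?F"
    by (simp_all add: contraction_def Abs_matroid_sel)
qed

text \<open>The direct sum lives on the disjoint union of the ground sets, so no disjointness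
  side condition is needed.\<close>

definition direct_sum :: "'a matroid \<Rightarrow> 'b matroid \<Rightarrow> ('a + 'b) matroid"  (infixl \<open>\<oplus>\<close> 65) where
  "M \<oplus> N = Abs_matroid (ground M <+> ground N, {X <+> Y |X Y. X \<in> indeps M \<and> Y \<in> indeps N})"

lemma Plus_decomp: "Z = (Inl -` Z) <+> (Inr -` Z)"
proof (rule set_eqI)
  fix x show "x \<in> Z \<longleftrightarrow> x \<in> (Inl -` Z) <+> (Inr -` Z)" by (cases x) auto
qed

lemma vimage_Plus [simp]: "Inl -` (X <+> Y) = X" "Inr -` (X <+> Y) = Y"
  by auto

lemma direct_sum_indeps_alt:
  "{X <+> Y |X Y. X \<in> indeps M \<and> Y \<in> indeps N} = {Z. Inl -` Z \<in> indeps M \<and> Inr -` Z \<in> indeps N}"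
  by (auto, metis Plus_decomp)

lemma direct_sum_sel:
  shows "ground (M \<oplus> N) = ground M <+> ground N"
    and "indeps (M \<oplus> N) = {Z. Inl -` Z \<in> indeps M \<and> Inr -` Z \<in> indeps N}"
proof -
  let ?F = "{Z. Inl -` Z \<in> indeps M \<and> Inr -` Z \<in> indeps N}"
  have "is_matroid (ground M <+> ground N) ?F"
    unfolding is_matroid_def
  proof (intro conjI ballI allI impI)
    show "?F \<subseteq> Pow (ground M <+> ground N)"
    proof
      fix Z assume "Z \<in> ?F"
      then have "(Inl -` Z) <+> (Inr -` Z) \<subseteq> ground M <+> ground N"
        using indeps_subset by (metis (no_types, lifting) Plus_def Un_mono image_mono mem_Collect_eq)
      then show "Z \<in> Pow (ground M <+> ground N)" using Plus_decomp[of Z] by simp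
    qed
  next
    fix X Y assume "X \<in> ?F" "Y \<subseteq> X"
    then show "Y \<in> ?F" by (auto intro: indeps_mono[OF _ vimage_mono])
  next
    fix X Y assume X: "X \<in> ?F" and Y: "Y \<in> ?F" and less: "card X < card Y"
    have c: "card Z = card (Inl -` Z) + card (Inr -` Z)" if "Z \<in> ?F" for Z :: "('a + 'b) set"
    proof -
      have "finite (Inl -` Z)" "finite (Inr -` Z)" using that indeps_finite by auto
      from card_Plus[OF this] show ?thesis by (simp flip: Plus_decomp)
    qed
    consider "card (Inl -` X) < card (Inl -` Y)" | "card (Inr -` X) < card (Inr -` Y)"
      using less c[OF X] c[OF Y] by linarith
    then show "\<exists>y\<in>Y - X. insert y X \<in> ?F"
    proof cases
      case 1
      then obtain y where y: "y \<in> Inl -` Y - Inl -` X" "insert y (Inl -` X) \<in> indeps M"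
        using indeps_augment[of "Inl -` X" M "Inl -` Y"] X Y by auto
      have "Inl -` (insert (Inl y) X) = insert y (Inl -` X)" "Inr -` (insert (Inl y) X) = Inr -` X"
        by auto
      then show ?thesis using y X by (intro bexI[of _ "Inl y"]) auto
    next
      case 2
      then obtain y where y: "y \<in> Inr -` Y - Inr -` X" "insert y (Inr -` X) \<in> indeps N"
        using indeps_augment[of "Inr -` X" N "Inr -` Y"] X Y by auto
      have "Inr -` (insert (Inr y) X) = insert y (Inr -` X)" "Inl -` (insert (Inr y) X) = Inl -` X"
        by auto
      then show ?thesis using y X by (intro bexI[of _ "Inr y"]) auto
    qed
  qed auto
  then show "ground (M \<oplus> N) = ground M <+> ground N" "indeps (M \<oplus> N) = ?F"
    by (simp_all add: direct_sum_def direct_sum_indeps_alt Abs_matroid_sel)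
qed


section \<open>Isomorphism classes\<close>

definition matroid_iso_by :: "('a \<Rightarrow> 'b) \<Rightarrow> 'a matroid \<Rightarrow> 'b matroid \<Rightarrow> bool" where
  "matroid_iso_by f M N \<longleftrightarrow> bij_betw f (ground M) (ground N) \<and>
     (\<forall>X. X \<subseteq> ground M \<longrightarrow> (X \<in> indeps M \<longleftrightarrow> f ` X \<in> indeps N))"

definition matroid_iso :: "'a matroid \<Rightarrow> 'b matroid \<Rightarrow> bool"  (infix \<open>\<simeq>\<close> 50) where
  "M \<simeq> N \<longleftrightarrow> (\<exists>f. matroid_iso_by f M N)"

lemma matroid_iso_refl: "M \<simeq> M"
  unfolding matroid_iso_def matroid_iso_by_def by (rule exI[of _ id]) auto

lemma matroid_iso_by_sym:
  assumes "matroid_iso_by f M N"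
  shows "matroid_iso_by (inv_into (ground M) f) N M"
proof -
  let ?g = "inv_into (ground M) f"
  have b: "bij_betw f (ground M) (ground N)" using assms by (simp add: matroid_iso_by_def)
  have "Y \<in> indeps N \<longleftrightarrow> ?g ` Y \<in> indeps M" if Y: "Y \<subseteq> ground N" for Y
  proof -
    have "f ` (?g ` Y) = Y"
      using Y b by (simp add: bij_betw_def image_inv_into_cancel)
    moreover have "?g ` Y \<subseteq> ground M"
      using Y b by (metis bij_betw_imp_surj_on image_mono bij_betw_inv_into)
    ultimately show ?thesis using assms unfolding matroid_iso_by_def by metis
  qed
  then show ?thesis using bij_betw_inv_into[OF b] by (auto simp: matroid_iso_by_def)
qed

lemma matroid_iso_sym: "M \<simeq> N \<Longrightarrow> N \<simeq> M"
  unfolding matroid_iso_def using matroid_iso_by_sym by blast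

lemma matroid_iso_by_trans:
  assumes f: "matroid_iso_by f M N" and g: "matroid_iso_by g N P"
  shows "matroid_iso_by (g \<circ> f) M P"
proof -
  have "f ` X \<subseteq> ground N" if "X \<subseteq> ground M" for X
    using f that by (metis bij_betw_imp_surj_on image_mono matroid_iso_by_def)
  then show ?thesis
    using f g by (auto simp: matroid_iso_by_def image_comp intro: bij_betw_trans)
qed

lemma matroid_iso_trans: "M \<simeq> N \<Longrightarrow> N \<simeq> P \<Longrightarrow> M \<simeq> P"
  unfolding matroid_iso_def using matroid_iso_by_trans by blast

text \<open>A finite matroid is isomorphic to one whose ground set consists of natural numbers, so
  the isomorphism classes of all finite matroids, over whatever type, are those of the
  matroids over \<^typ>\<open>nat\<close>.\<close>

quotient_type mclass = "nat matroid" / "matroid_iso :: nat matroid \<Rightarrow> nat matroid \<Rightarrow> bool"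
  by (rule equivpI)
     (auto intro!: reflpI sympI transpI intro: matroid_iso_refl matroid_iso_sym matroid_iso_trans)

definition iso_class :: "'a matroid \<Rightarrow> mclass" where
  "iso_class M = abs_mclass (SOME N. M \<simeq> N)"

lemma matroid_transport:
  assumes inj: "inj_on f (ground M)"
  shows "\<exists>N. matroid_iso_by f M N"
proof -
  let ?F = "(`) f ` indeps M"
  have inj': "inj_on f X" if "X \<in> indeps M" for X
    using inj indeps_subset[OF that] by (rule inj_on_subset)
  have m: "is_matroid (f ` ground M) ?F"
    unfolding is_matroid_def
  proof (intro conjI ballI allI impI)
    fix X Y assume "X \<in> ?F" "Y \<subseteq> X"
    then obtain X' where X': "X' \<in> indeps M" "Y \<subseteq> f ` X'" by auto
    then obtain Y' where "Y' \<subseteq> X'" "Y = f ` Y'" by (auto simp: subset_image_iff)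
    then have "Y' \<in> indeps M" by (intro indeps_mono[OF X'(1)])
    then show "Y \<in> ?F" using \<open>Y = f ` Y'\<close> by simp
  next
    fix X Y assume "X \<in> ?F" "Y \<in> ?F" and less: "card X < card Y"
    then obtain X' Y' where XY: "X' \<in> indeps M" "X = f ` X'" "Y' \<in> indeps M" "Y = f ` Y'" by auto
    then have "card X' < card Y'" using less inj' by (simp add: card_image)
    then obtain y where y: "y \<in> Y' - X'" "insert y X' \<in> indeps M"
      using indeps_augment XY by blast
    have "f y \<notin> X"
      using inj_onD[OF inj'[OF y(2)], of y] y XY by auto
    then show "\<exists>y\<in>Y - X. insert y X \<in> ?F"
      using y XY by (intro bexI[of _ "f y"]) (auto intro!: image_eqI[of _ _ "insert y X'"])
  qed (use indeps_subset in \<open>auto intro: image_eqI[of _ _ "{}"]\<close>)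
  have "X \<in> indeps M \<longleftrightarrow> f ` X \<in> ?F" if "X \<subseteq> ground M" for X
  proof
    assume "f ` X \<in> ?F"
    then obtain Y where Y: "Y \<in> indeps M" "f ` X = f ` Y" by auto
    then have "X = Y" using inj_on_image_eq_iff[OF inj that indeps_subset[OF Y(1)]] by simp
    then show "X \<in> indeps M" using Y by simp
  qed simp
  then have "matroid_iso_by f M (Abs_matroid (f ` ground M, ?F))"
    using inj by (auto simp: matroid_iso_by_def Abs_matroid_sel[OF m] bij_betw_def)
  then show ?thesis by blast
qed

lemma matroid_iso_nat: "\<exists>N :: nat matroid. M \<simeq> N"
proof -
  obtain f :: "'a \<Rightarrow> nat" where "inj_on f (ground M)"
    using finite_imp_inj_to_nat_seg[OF finite_ground[of M]] by metis
  from matroid_transport[OF this] show ?thesis unfolding matroid_iso_def by metis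
qed

lemma iso_class_eq_iff: "iso_class M = iso_class N \<longleftrightarrow> M \<simeq> N"
proof -
  have "M \<simeq> (SOME N :: nat matroid. M \<simeq> N)" for M :: "'c matroid"
    using matroid_iso_nat[of M] by (rule someI_ex)
  then show ?thesis unfolding iso_class_def mclass.abs_eq_iff
    by (meson matroid_iso_sym matroid_iso_trans)
qed

lemma iso_class_nat: "iso_class (M :: nat matroid) = abs_mclass M"
  unfolding iso_class_def mclass.abs_eq_iff
  by (rule matroid_iso_sym, rule someI[of _ M], rule matroid_iso_refl)

lemma iso_class_rep [simp]: "iso_class (rep_mclass c) = c"
  unfolding iso_class_nat using Quotient_abs_rep[OF Quotient_mclass] .

lemma iso_class_cases: obtains M :: "nat matroid" where "c = iso_class M"
  using iso_class_rep by metis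

lemma direct_sum_cong:
  assumes "M \<simeq> M'" "N \<simeq> N'"
  shows "M \<oplus> N \<simeq> M' \<oplus> N'"
proof -
  obtain f g where f: "matroid_iso_by f M M'" and g: "matroid_iso_by g N N'"
    using assms by (auto simp: matroid_iso_def)
  have im: "map_sum f g ` (A <+> B) = f ` A <+> g ` B" for A B
    by (simp add: Plus_def image_Un image_image)
  have im': "map_sum f g ` X = f ` (Inl -` X) <+> g ` (Inr -` X)" for X
    by (simp flip: im Plus_decomp)
  have "matroid_iso_by (map_sum f g) (M \<oplus> N) (M' \<oplus> N')"
    unfolding matroid_iso_by_def
  proof (intro conjI allI impI)
    have "inj_on (map_sum f g) (ground M <+> ground N)"
    proof -
      have i: "inj_on f (ground M)" "inj_on g (ground N)"
        using f g by (auto simp: matroid_iso_by_def bij_betw_def)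
      show ?thesis
        by (rule inj_onI) (auto simp: Plus_def dest: inj_onD[OF i(1)] inj_onD[OF i(2)])
    qed
    then show "bij_betw (map_sum f g) (ground (M \<oplus> N)) (ground (M' \<oplus> N'))"
      using f g by (simp add: bij_betw_def direct_sum_sel matroid_iso_by_def im)
  next
    fix X assume "X \<subseteq> ground (M \<oplus> N)"
    then have "Inl -` X \<subseteq> ground M" "Inr -` X \<subseteq> ground N" by (auto simp: direct_sum_sel)
    then show "X \<in> indeps (M \<oplus> N) \<longleftrightarrow> map_sum f g ` X \<in> indeps (M' \<oplus> N')"
      using f g by (simp add: direct_sum_sel matroid_iso_by_def im')
  qed
  then show ?thesis unfolding matroid_iso_def by blast
qed

lemma direct_sum_comm: "M \<oplus> N \<simeq> N \<oplus> M"
  unfolding matroid_iso_def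
proof (intro exI)
  define s :: "'a + 'b \<Rightarrow> 'b + 'a" where "s = case_sum Inr Inl"
  have [simp]: "s (Inl x) = Inr x" "s (Inr y) = Inl y" for x y by (simp_all add: s_def)
  have im: "s ` Z = (Inr -` Z) <+> (Inl -` Z)" for Z
  proof -
    have "s ` (A <+> B) = B <+> A" for A B by (auto simp: Plus_def image_Un image_image)
    from this[of "Inl -` Z" "Inr -` Z"] show ?thesis by (simp flip: Plus_decomp)
  qed
  show "matroid_iso_by s (M \<oplus> N) (N \<oplus> M)"
    by (auto simp: matroid_iso_by_def direct_sum_sel bij_betw_def im inj_on_def)
qed

lemma direct_sum_assoc: "(M \<oplus> N) \<oplus> P \<simeq> M \<oplus> (N \<oplus> P)"
  unfolding matroid_iso_def
proof (intro exI)
  define s :: "('a + 'b) + 'c \<Rightarrow> 'a + ('b + 'c)"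
    where "s = case_sum (case_sum Inl (Inr \<circ> Inl)) (Inr \<circ> Inr)"
  have [simp]: "s (Inl (Inl x)) = Inl x" "s (Inl (Inr y)) = Inr (Inl y)" "s (Inr z) = Inr (Inr z)"
    for x y z by (simp_all add: s_def)
  have im: "s ` Z = (Inl -` (Inl -` Z)) <+> ((Inr -` (Inl -` Z)) <+> (Inr -` Z))" for Z
  proof -
    have "s ` ((A <+> B) <+> C) = A <+> (B <+> C)" for A B C
      by (auto simp: Plus_def image_Un image_image)
    from this[of "Inl -` (Inl -` Z)" "Inr -` (Inl -` Z)" "Inr -` Z"] show ?thesis
      by (simp flip: Plus_decomp)
  qed
  show "matroid_iso_by s ((M \<oplus> N) \<oplus> P) (M \<oplus> (N \<oplus> P))"
    by (auto simp: matroid_iso_by_def direct_sum_sel bij_betw_def im inj_on_def)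
qed

lemma uniform_empty_sel [simp]:
  "ground (uniform_matroid m {}) = {}" "indeps (uniform_matroid m {}) = {{}}"
  by (auto simp: uniform_matroid_sel)

lemma direct_sum_empty: "(uniform_matroid 0 {} :: 'b matroid) \<oplus> M \<simeq> M"
  unfolding matroid_iso_def
proof (intro exI)
  let ?U = "uniform_matroid 0 {} :: 'b matroid"
  show "matroid_iso_by projr (?U \<oplus> M) M"
    unfolding matroid_iso_by_def
  proof (intro conjI allI impI)
    show "bij_betw projr (ground (?U \<oplus> M)) (ground M)"
      by (force simp: bij_betw_def direct_sum_sel inj_on_def Plus_def image_image)
    fix X assume X: "X \<subseteq> ground (?U \<oplus> M)"
    then have "Inl -` X = {}" by (auto simp: direct_sum_sel)
    moreover have "projr ` X = Inr -` X"
      using X by (force simp: direct_sum_sel Plus_def)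
    ultimately show "X \<in> indeps (?U \<oplus> M) \<longleftrightarrow> projr ` X \<in> indeps M"
      by (simp add: direct_sum_sel)
  qed
qed

text \<open>Under direct sum the isomorphism classes form a commutative monoid, written additively;
  its monoid algebra is then \<^typ>\<open>mclass \<Rightarrow>\<^sub>0 'k\<close> with the multiplication of
  \<^theory>\<open>HOL-Library.Poly_Mapping\<close>.\<close>

instantiation mclass :: comm_monoid_add
begin

definition zero_mclass :: mclass where
  "0 = iso_class (uniform_matroid 0 ({} :: nat set))"

definition plus_mclass :: "mclass \<Rightarrow> mclass \<Rightarrow> mclass" where
  "a + b = iso_class (rep_mclass a \<oplus> rep_mclass b)"

lemma iso_class_direct_sum: "iso_class (M \<oplus> N) = iso_class M + iso_class N"
  unfolding plus_mclass_def iso_class_eq_iff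
  by (rule direct_sum_cong) (simp_all flip: iso_class_eq_iff)

instance
proof
  fix a b c :: mclass
  obtain M N P :: "nat matroid" where [simp]: "a = iso_class M" "b = iso_class N" "c = iso_class P"
    by (metis iso_class_cases)
  show "a + b + c = a + (b + c)"
    by (simp add: iso_class_eq_iff direct_sum_assoc flip: iso_class_direct_sum)
  show "a + b = b + a"
    by (simp add: iso_class_eq_iff direct_sum_comm flip: iso_class_direct_sum)
  show "0 + a = a"
    by (simp add: zero_mclass_def iso_class_eq_iff direct_sum_empty flip: iso_class_direct_sum)
qed

end

text \<open>A class of matroids is given by the set of its isomorphism classes.\<close>

definition minor_sum_closed :: "mclass set \<Rightarrow> bool" where
  "minor_sum_closed \<M> \<longleftrightarrow>
     (\<forall>a\<in>\<M>. \<forall>b\<in>\<M>. a + b \<in> \<M>) \<and>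
     (\<forall>M :: nat matroid. iso_class M \<in> \<M> \<longrightarrow>
        (\<forall>A\<subseteq>ground M. iso_class (restriction M A) \<in> \<M> \<and> iso_class (contraction M A) \<in> \<M>))"

definition contains_uniform :: "mclass set \<Rightarrow> bool" where
  "contains_uniform \<M> \<longleftrightarrow>
     (\<forall>(m::nat) (E :: nat set). finite E \<longrightarrow> m \<le> card E \<longrightarrow> iso_class (uniform_matroid m E) \<in> \<M>)"


section \<open>The restriction-contraction Hopf algebra\<close>

text \<open>The free module on \<open>'b\<close> is \<^typ>\<open>'b \<Rightarrow>\<^sub>0 'k\<close>, and the tensor product of the free modules
  on \<open>'b\<close> and \<open>'c\<close> is \<^typ>\<open>('b \<times> 'c) \<Rightarrow>\<^sub>0 'k\<close>, the pair \<^term>\<open>(b, c)\<close> standing for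
  the elementary tensor of the basis vectors \<^term>\<open>b\<close> and \<^term>\<open>c\<close>.\<close>

definition scale :: "'k \<Rightarrow> ('b \<Rightarrow>\<^sub>0 'k) \<Rightarrow> ('b \<Rightarrow>\<^sub>0 'k::field)" where
  "scale c f = Poly_Mapping.map ((*) c) f"

definition linear_extension :: "('b \<Rightarrow> ('c \<Rightarrow>\<^sub>0 'k)) \<Rightarrow> ('b \<Rightarrow>\<^sub>0 'k) \<Rightarrow> ('c \<Rightarrow>\<^sub>0 'k::field)" where
  "linear_extension F f = (\<Sum>b\<in>Poly_Mapping.keys f. scale (Poly_Mapping.lookup f b) (F b))"

definition tensor :: "('b \<Rightarrow>\<^sub>0 'k) \<Rightarrow> ('c \<Rightarrow>\<^sub>0 'k) \<Rightarrow> (('b \<times> 'c) \<Rightarrow>\<^sub>0 'k::field)" where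
  "tensor f g = (\<Sum>b\<in>Poly_Mapping.keys f. \<Sum>c\<in>Poly_Mapping.keys g.
     Poly_Mapping.single (b, c) (Poly_Mapping.lookup f b * Poly_Mapping.lookup g c))"

definition tensor_map ::
  "(('b \<Rightarrow>\<^sub>0 'k) \<Rightarrow> ('d \<Rightarrow>\<^sub>0 'k)) \<Rightarrow> (('c \<Rightarrow>\<^sub>0 'k) \<Rightarrow> ('e \<Rightarrow>\<^sub>0 'k)) \<Rightarrow>
     (('b \<times> 'c) \<Rightarrow>\<^sub>0 'k) \<Rightarrow> (('d \<times> 'e) \<Rightarrow>\<^sub>0 'k::field)" where
  "tensor_map S T = linear_extension
     (\<lambda>(b, c). tensor (S (Poly_Mapping.single b 1)) (T (Poly_Mapping.single c 1)))"

definition hopf_carrier :: "mclass set \<Rightarrow> (mclass \<Rightarrow>\<^sub>0 'k::field) set" where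
  "hopf_carrier \<M> = {f. Poly_Mapping.keys f \<subseteq> \<M>}"

definition matroid_vec :: "'a matroid \<Rightarrow> (mclass \<Rightarrow>\<^sub>0 'k::field)"  (\<open>\<langle>_\<rangle>\<close>) where
  "\<langle>M\<rangle> = Poly_Mapping.single (iso_class M) 1"

definition hopf_unit :: "'k \<Rightarrow> (mclass \<Rightarrow>\<^sub>0 'k::field)" where
  "hopf_unit c = scale c 1"

definition hopf_mult :: "((mclass \<times> mclass) \<Rightarrow>\<^sub>0 'k) \<Rightarrow> (mclass \<Rightarrow>\<^sub>0 'k::field)" where
  "hopf_mult = linear_extension (\<lambda>(a, b). Poly_Mapping.single a 1 * Poly_Mapping.single b 1)"

text \<open>The counit sends the class of the empty matroid to \<open>1\<close> and every other class to \<open>0\<close>.\<close>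

definition hopf_counit :: "(mclass \<Rightarrow>\<^sub>0 'k) \<Rightarrow> 'k::field" where
  "hopf_counit f = Poly_Mapping.lookup f 0"

definition hopf_comult :: "(mclass \<Rightarrow>\<^sub>0 'k) \<Rightarrow> ((mclass \<times> mclass) \<Rightarrow>\<^sub>0 'k::field)" where
  "hopf_comult = linear_extension
     (\<lambda>c. let M = rep_mclass c in
        \<Sum>A\<in>Pow (ground M). tensor \<langle>restriction M A\<rangle> \<langle>contraction M A\<rangle>)"

definition linear_on_carrier :: "mclass set \<Rightarrow> ((mclass \<Rightarrow>\<^sub>0 'k::field) \<Rightarrow> (mclass \<Rightarrow>\<^sub>0 'k)) \<Rightarrow> bool" where
  "linear_on_carrier \<M> S \<longleftrightarrow>
     (\<forall>f\<in>hopf_carrier \<M>. S f \<in> hopf_carrier \<M>) \<and>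
     (\<forall>f\<in>hopf_carrier \<M>. \<forall>g\<in>hopf_carrier \<M>. S (f + g) = S f + S g) \<and>
     (\<forall>c. \<forall>f\<in>hopf_carrier \<M>. S (scale c f) = scale c (S f))"

text \<open>An antipode is a two-sided inverse of the identity for the convolution product.\<close>

definition is_antipode :: "mclass set \<Rightarrow> ((mclass \<Rightarrow>\<^sub>0 'k::field) \<Rightarrow> (mclass \<Rightarrow>\<^sub>0 'k)) \<Rightarrow> bool" where
  "is_antipode \<M> S \<longleftrightarrow> linear_on_carrier \<M> S \<and>
     (\<forall>f\<in>hopf_carrier \<M>.
        hopf_mult (tensor_map S id (hopf_comult f)) = hopf_unit (hopf_counit f) \<and>
        hopf_mult (tensor_map id S (hopf_comult f)) = hopf_unit (hopf_counit f))"

text \<open>The coproduct does not depend on the representative chosen in its definition.\<close>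

lemma restriction_iso:
  assumes f: "matroid_iso_by f M N" and A: "A \<subseteq> ground M"
  shows "matroid_iso_by f (restriction M A) (restriction N (f ` A))"
proof -
  have b: "bij_betw f (ground M) (ground N)" using f by (simp add: matroid_iso_by_def)
  have fA: "ground N \<inter> f ` A = f ` A" "ground M \<inter> A = A"
    using A b by (auto simp: bij_betw_def)
  have "inj_on f A" using A b by (meson bij_betw_def inj_on_subset)
  then show ?thesis
    using f A unfolding matroid_iso_by_def restriction_sel fA
    by (auto simp: bij_betw_def image_mono)
qed

lemma is_basis_iso:
  assumes f: "matroid_iso_by f M N" and B: "is_basis M B"
  shows "is_basis N (f ` B)"
proof -
  let ?g = "inv_into (ground M) f"
  have b: "bij_betw f (ground M) (ground N)" using f by (simp add: matroid_iso_by_def)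
  have BM: "B \<in> indeps M" "B \<subseteq> ground M" using B indeps_subset by (auto simp: is_basis_def)
  have "X = f ` B" if X: "X \<in> indeps N" "f ` B \<subseteq> X" for X
  proof -
    have XN: "X \<subseteq> ground N" using X(1) by (rule indeps_subset)
    obtain Y where Y: "Y \<subseteq> ground M" "X = f ` Y"
      using XN b by (metis bij_betw_imp_surj_on subset_imageE)
    then have "Y \<in> indeps M" using X f by (simp add: matroid_iso_by_def)
    moreover have "B \<subseteq> Y"
    proof
      fix x assume x: "x \<in> B"
      then have "f x \<in> f ` Y" using X(2) Y(2) by blast
      then show "x \<in> Y"
        using inj_on_image_mem_iff[OF bij_betw_imp_inj_on[OF b] _ Y(1), of x] x BM(2) by blast
    qed
    ultimately have "Y = B" using B by (auto simp: is_basis_def)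
    then show ?thesis using Y by simp
  qed
  moreover have "f ` B \<in> indeps N" using BM f by (simp add: matroid_iso_by_def)
  ultimately show ?thesis by (auto simp: is_basis_def)
qed

lemma contraction_iso:
  assumes f: "matroid_iso_by f M N" and A: "A \<subseteq> ground M"
  shows "matroid_iso_by f (contraction M A) (contraction N (f ` A))"
proof -
  have b: "bij_betw f (ground M) (ground N)" using f by (simp add: matroid_iso_by_def)
  have inj: "inj_on f (ground M)" and im: "f ` ground M = ground N"
    using b by (auto simp: bij_betw_def)
  have diff: "f ` (ground M - A) = ground N - f ` A"
    using inj_on_image_set_diff[OF inj, of "ground M" A] A im by auto
  obtain B where B: "is_basis (restriction M A) B" using is_basis_exists by blast
  have B': "is_basis (restriction N (f ` A)) (f ` B)"
    by (rule is_basis_iso[OF restriction_iso[OF f A] B])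
  have BM: "B \<subseteq> ground M" using B indeps_subset by (auto simp: is_basis_def restriction_sel)
  have "X \<in> indeps (contraction M A) \<longleftrightarrow> f ` X \<in> indeps (contraction N (f ` A))"
    if X: "X \<subseteq> ground M - A" for X
  proof -
    have fX: "f ` X \<subseteq> ground N - f ` A" using X diff by (metis image_mono)
    then have dis: "f ` X \<inter> f ` A = {}" by blast
    have "X \<in> indeps (contraction M A) \<longleftrightarrow> X \<union> B \<in> indeps M"
      using X B contraction_basis_change[of M A _ B X] by (auto simp: contraction_sel)
    also have "\<dots> \<longleftrightarrow> f ` (X \<union> B) \<in> indeps N"
      using f X BM unfolding matroid_iso_by_def by blast
    also have "f ` (X \<union> B) = f ` X \<union> f ` B" by (rule image_Un)
    also have "f ` X \<union> f ` B \<in> indeps N \<longleftrightarrow> f ` X \<in> indeps (contraction N (f ` A))"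
      using fX B' contraction_basis_change[OF _ B' dis] by (auto simp: contraction_sel)
    finally show ?thesis .
  qed
  moreover have "bij_betw f (ground M - A) (ground N - f ` A)"
    using inj diff by (auto simp: bij_betw_def intro: inj_on_subset)
  ultimately show ?thesis by (auto simp: matroid_iso_by_def contraction_sel)
qed

lemma scale_one [simp]: "scale 1 f = f"
  by (rule poly_mapping_eqI) (simp add: scale_def Poly_Mapping.map.rep_eq when_def)

lemma hopf_comult_matroid_vec:
  "hopf_comult (\<langle>M\<rangle> :: mclass \<Rightarrow>\<^sub>0 'k::field) =
     (\<Sum>A\<in>Pow (ground M). tensor \<langle>restriction M A\<rangle> \<langle>contraction M A\<rangle>)"
proof -
  define N where "N = rep_mclass (iso_class M)"
  have "M \<simeq> N" unfolding N_def iso_class_eq_iff[symmetric] by simp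
  then obtain f where f: "matroid_iso_by f M N" by (auto simp: matroid_iso_def)
  have b: "bij_betw ((`) f) (Pow (ground M)) (Pow (ground N))"
    using f by (simp add: matroid_iso_by_def bij_betw_Pow)
  have "hopf_comult (\<langle>M\<rangle> :: mclass \<Rightarrow>\<^sub>0 'k) =
      (\<Sum>A\<in>Pow (ground N). tensor \<langle>restriction N A\<rangle> \<langle>contraction N A\<rangle>)"
    by (simp add: hopf_comult_def linear_extension_def matroid_vec_def N_def Let_def)
  also have "\<dots> = (\<Sum>A\<in>Pow (ground M).
      tensor \<langle>restriction N (f ` A)\<rangle> \<langle>contraction N (f ` A)\<rangle>)"
    by (rule sum.reindex_bij_betw[OF b, symmetric])
  also have "\<dots> = (\<Sum>A\<in>Pow (ground M). tensor \<langle>restriction M A\<rangle> \<langle>contraction M A\<rangle>)"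
  proof (rule sum.cong[OF refl])
    fix A assume "A \<in> Pow (ground M)"
    then have "restriction M A \<simeq> restriction N (f ` A)" "contraction M A \<simeq> contraction N (f ` A)"
      using restriction_iso[OF f] contraction_iso[OF f] by (auto simp: matroid_iso_def)
    then have "iso_class (restriction M A) = iso_class (restriction N (f ` A))"
      "iso_class (contraction M A) = iso_class (contraction N (f ` A))"
      by (simp_all add: iso_class_eq_iff)
    then show "tensor \<langle>restriction N (f ` A)\<rangle> \<langle>contraction N (f ` A)\<rangle> =
        (tensor \<langle>restriction M A\<rangle> \<langle>contraction M A\<rangle> :: (mclass \<times> mclass) \<Rightarrow>\<^sub>0 'k)"
      by (simp add: matroid_vec_def)
  qed
  finally show ?thesis .
qed

lemma matroid_vec_direct_sum: "\<langle>M \<oplus> N\<rangle> = \<langle>M\<rangle> * \<langle>N\<rangle>"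
  by (simp add: matroid_vec_def iso_class_direct_sum mult_single)


section \<open>Ordered set partitions and the map \<open>\<iota>\<close>\<close>

definition ordered_set_partitions :: "'a set \<Rightarrow> 'a set list set" where
  "ordered_set_partitions E = {\<pi>. distinct \<pi> \<and> partition_on E (set \<pi>)}"

definition osp_sgn :: "'a set list \<Rightarrow> 'r::ring_1" where
  "osp_sgn \<pi> = (if even (length \<pi>) then 1 else - 1)"

text \<open>Positions in lists count from \<open>0\<close>, so \<open>B\<^sub>\<ell>\<close> is \<^term>\<open>\<pi> ! crit_index m \<pi>\<close>. As in the
  one-based convention, the first part is critical if \<^term>\<open>m = 0\<close>.\<close>

definition size_upto :: "'a set list \<Rightarrow> nat \<Rightarrow> nat" where
  "size_upto \<pi> i = (\<Sum>B\<leftarrow>take (Suc i) \<pi>. card B)"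

definition crit_index :: "nat \<Rightarrow> 'a set list \<Rightarrow> nat" where
  "crit_index m \<pi> = (LEAST i. m \<le> size_upto \<pi> i)"

definition initial_part :: "nat \<Rightarrow> 'a set list \<Rightarrow> 'a set" where
  "initial_part m \<pi> = \<Union>(set (take (crit_index m \<pi>) \<pi>))"

text \<open>The empty list, the only ordered partition of the empty set, has no critical part.\<close>

definition crit_part :: "nat \<Rightarrow> 'a set list \<Rightarrow> 'a set" where
  "crit_part m \<pi> = (if crit_index m \<pi> < length \<pi> then \<pi> ! crit_index m \<pi> else {})"

text \<open>\<^term>\<open>exact m \<pi>\<close> says that \<open>k\<^sub>1 + \<dots> + k\<^sub>\<ell> = m\<close>.\<close>

definition exact :: "nat \<Rightarrow> 'a set list \<Rightarrow> bool" where
  "exact m \<pi> \<longleftrightarrow> size_upto \<pi> (crit_index m \<pi>) = m"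

definition order_max :: "('a \<times> 'a) set \<Rightarrow> 'a set \<Rightarrow> 'a" where
  "order_max r B = (THE x. x \<in> B \<and> (\<forall>y\<in>B. (y, x) \<in> r))"

definition can_split :: "nat \<Rightarrow> 'a set list \<Rightarrow> nat \<Rightarrow> bool" where
  "can_split m \<pi> i \<longleftrightarrow> i < length \<pi> \<and> card (\<pi> ! i) > 1 \<and> (exact m \<pi> \<or> i \<noteq> crit_index m \<pi>)"

text \<open>The condition \<^term>\<open>exact m \<pi> \<or> Suc i \<noteq> crit_index m \<pi>\<close> on the part being merged into is
  the counterpart of the condition for splitting. Without it, a merge into a critical part
  with \<open>k\<^sub>1 + \<dots> + k\<^sub>\<ell> > m\<close> would be allowed; it would move an element from \<open>I\<close> to \<open>L\<close>, thus change
  the term of Takeuchi's formula, and could not be undone by a split: for \<open>m = 2\<close> it sends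
  \<open>({3}, {1, 2})\<close> to the fixed point \<open>({1, 2, 3})\<close>.\<close>

definition can_merge :: "('a \<times> 'a) set \<Rightarrow> nat \<Rightarrow> 'a set list \<Rightarrow> nat \<Rightarrow> bool" where
  "can_merge r m \<pi> i \<longleftrightarrow> Suc i < length \<pi> \<and> card (\<pi> ! i) = 1 \<and> i \<noteq> crit_index m \<pi> \<and>
     (exact m \<pi> \<or> Suc i \<noteq> crit_index m \<pi>) \<and>
     (\<forall>x\<in>\<pi> ! i. \<forall>y\<in>\<pi> ! Suc i. (y, x) \<in> r \<and> y \<noteq> x)"

definition split_at :: "('a \<times> 'a) set \<Rightarrow> 'a set list \<Rightarrow> nat \<Rightarrow> 'a set list" where
  "split_at r \<pi> i =
     take i \<pi> @ [{order_max r (\<pi> ! i)}, \<pi> ! i - {order_max r (\<pi> ! i)}] @ drop (Suc i) \<pi>"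

definition merge_at :: "'a set list \<Rightarrow> nat \<Rightarrow> 'a set list" where
  "merge_at \<pi> i = take i \<pi> @ [\<pi> ! i \<union> \<pi> ! Suc i] @ drop (Suc (Suc i)) \<pi>"

definition iota :: "('a \<times> 'a) set \<Rightarrow> nat \<Rightarrow> 'a set list \<Rightarrow> 'a set list" where
  "iota r m \<pi> =
     (if \<exists>i. can_split m \<pi> i \<or> can_merge r m \<pi> i
      then let i = (LEAST i. can_split m \<pi> i \<or> can_merge r m \<pi> i)
           in if can_split m \<pi> i then split_at r \<pi> i else merge_at \<pi> i
      else \<pi>)"

end

theory Submission
  imports Defs
begin

text \<open>Solving the convolution identity for \<^term>\<open>S\<close> on \<open>U\<^sup>m\<^sub>n\<close> expresses the antipode through its
  values on the contractions \<open>U\<^sup>m\<^sub>n / A\<close>, \<open>A \<noteq> \<emptyset>\<close>; unrolling this recursion gives Takeuchi's sum over all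
  ordered set partitions. The terms of the non-fixed partitions cancel in pairs. On the level
  of cumulative sizes, splitting a part inserts and merging removes an intermediate size, and
  both are allowed exactly when \<open>m\<close> is not strictly inside the unsplit part (or \<open>m = 0\<close> and the
  part is the first one). Then that part consists only of loops or only of coloops of the
  minor it stands for, so the term changes just its sign. This local form of the conditions
  gives a recursion on lists whose fixed points are those of \<^const>\<open>iota\<close>.\<close>

section \<open>Linear extensions and convolution\<close>

lemma lookup_scale [simp]: "Poly_Mapping.lookup (scale c f) x = c * Poly_Mapping.lookup f x"
  by (simp add: scale_def Poly_Mapping.map.rep_eq when_def)

lemma scale_zero_left [simp]: "scale 0 f = 0"
  by (rule poly_mapping_eqI) simp

lemma scale_add_left: "scale (a + b) f = scale a f + scale b f"
  by (rule poly_mapping_eqI) (simp add: lookup_add distrib_right)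

lemma scale_single: "scale c (Poly_Mapping.single x d) = Poly_Mapping.single x (c * d)"
  by (rule poly_mapping_eqI) (simp add: lookup_single when_def)

text \<open>Keys of \<open>f + g\<close> can cancel, so additivity needs the three expansions over
  one common finite index set.\<close>

lemma linear_extension_superset:
  assumes "finite K" "Poly_Mapping.keys f \<subseteq> K"
  shows "linear_extension F f = (\<Sum>b\<in>K. scale (Poly_Mapping.lookup f b) (F b))"
  unfolding linear_extension_def
  by (rule sum.mono_neutral_left) (use assms in \<open>auto simp: in_keys_iff\<close>)

lemma linear_extension_zero [simp]: "linear_extension F 0 = 0"
  by (simp add: linear_extension_def)

lemma linear_extension_add:
  "linear_extension F (f + g) = linear_extension F f + linear_extension F g"
proof -
  define K where "K = Poly_Mapping.keys f \<union> Poly_Mapping.keys g"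
  have K: "finite K" "Poly_Mapping.keys f \<subseteq> K" "Poly_Mapping.keys g \<subseteq> K"
      "Poly_Mapping.keys (f + g) \<subseteq> K"
    using keys_add[of f g] by (auto simp: K_def)
  show ?thesis
    using K by (simp add: linear_extension_superset[of K] lookup_add scale_add_left sum.distrib)
qed

lemma linear_extension_sum:
  "linear_extension F (\<Sum>i\<in>A. f i) = (\<Sum>i\<in>A. linear_extension F (f i))"
  by (induction A rule: infinite_finite_induct) (simp_all add: linear_extension_add)

lemma linear_extension_single:
  "linear_extension F (Poly_Mapping.single b c) = scale c (F b)"
  by (cases "c = 0") (simp_all add: linear_extension_def)

lemma sum_single_lookup:
  fixes f :: "'a \<Rightarrow>\<^sub>0 'b::comm_monoid_add"
  shows "(\<Sum>b\<in>Poly_Mapping.keys f. Poly_Mapping.single b (Poly_Mapping.lookup f b)) = f"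
proof (rule poly_mapping_eqI)
  fix x
  show "Poly_Mapping.lookup (\<Sum>b\<in>Poly_Mapping.keys f.
      Poly_Mapping.single b (Poly_Mapping.lookup f b)) x = Poly_Mapping.lookup f x"
    by (simp add: lookup_sum lookup_single when_def in_keys_iff)
qed

lemma tensor_single:
  "tensor (Poly_Mapping.single b x) (Poly_Mapping.single c y) = Poly_Mapping.single (b, c) (x * y)"
  by (simp add: tensor_def)

text \<open>Turns convolution into the product of the monoid algebra: both sides expand to the same
  double sum over keys.\<close>

lemma hopf_mult_tensor: "hopf_mult (tensor f g) = f * g"
proof -
  have "hopf_mult (tensor f g) = (\<Sum>b\<in>Poly_Mapping.keys f. \<Sum>c\<in>Poly_Mapping.keys g.
      Poly_Mapping.single b (Poly_Mapping.lookup f b) *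
      Poly_Mapping.single c (Poly_Mapping.lookup g c))"
    by (simp add: hopf_mult_def tensor_def linear_extension_sum linear_extension_single
        mult_single scale_single)
  also have "\<dots> = f * g"
    by (simp add: sum_single_lookup flip: sum_product)
  finally show ?thesis .
qed

lemma tensor_map_sum:
  "tensor_map S T (\<Sum>i\<in>A. f i) = (\<Sum>i\<in>A. tensor_map S T (f i))"
  by (simp add: tensor_map_def linear_extension_sum)

lemma tensor_map_matroid_vec:
  "tensor_map S T (tensor \<langle>M\<rangle> \<langle>N\<rangle>) = tensor (S \<langle>M\<rangle>) (T \<langle>N\<rangle>)"
  by (simp add: tensor_map_def tensor_single matroid_vec_def linear_extension_single)

lemma hopf_convolution_matroid_vec:
  fixes S T :: "(mclass \<Rightarrow>\<^sub>0 'b::field) \<Rightarrow> (mclass \<Rightarrow>\<^sub>0 'b)" and M :: "'a matroid"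
  shows "hopf_mult (tensor_map S T (hopf_comult \<langle>M\<rangle>)) =
    (\<Sum>A\<in>Pow (ground M). S \<langle>restriction M A\<rangle> * T \<langle>contraction M A\<rangle>)"
proof -
  have "hopf_mult (\<Sum>A\<in>Pow (ground M). f A) = (\<Sum>A\<in>Pow (ground M). hopf_mult (f A))"
    for f :: "'a set \<Rightarrow> (mclass \<times> mclass) \<Rightarrow>\<^sub>0 'b::field"
    by (simp add: hopf_mult_def linear_extension_sum)
  then show ?thesis
    by (simp add: hopf_comult_matroid_vec tensor_map_sum tensor_map_matroid_vec hopf_mult_tensor)
qed

section \<open>Uniform matroids\<close>

lemma matroid_eqI:
  assumes "ground M = ground N" "indeps M = indeps N"
  shows "M = N"
  using assms
  by (metis Rep_matroid_inject ground.rep_eq indeps.rep_eq prod.expand)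

text \<open>Every subset of \<open>A\<close> is independent on both sides. This serves to meet the
  rank bound in \<open>contains_uniform\<close> and to adjust the rank of a free part.\<close>

lemma uniform_matroid_truncate:
  assumes "finite A" "card A \<le> m"
  shows "uniform_matroid m A = uniform_matroid (card A) A"
  by (rule matroid_eqI)
     (use assms card_mono[OF assms(1)] in \<open>auto simp: uniform_matroid_sel intro: order_trans\<close>)

lemma restriction_uniform:
  assumes "finite E" "A \<subseteq> E"
  shows "restriction (uniform_matroid m E) A = uniform_matroid m A"
  using assms finite_subset[OF assms(2,1)]
  by (intro matroid_eqI) (auto simp: restriction_sel uniform_matroid_sel)

lemma card_basis_uniform:
  assumes "finite A" "is_basis (uniform_matroid m A) B"
  shows "B \<subseteq> A" "card B = min m (card A)"
proof -
  show BA: "B \<subseteq> A" using assms by (auto simp: is_basis_def uniform_matroid_sel)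
  have le: "card B \<le> m" using assms by (auto simp: is_basis_def uniform_matroid_sel)
  have fin: "finite B" using BA assms(1) by (rule finite_subset)
  show "card B = min m (card A)"
  proof (rule ccontr)
    assume "\<not> ?thesis"
    then have lt: "card B < m" "card B < card A"
      using le card_mono[OF assms(1) BA] by auto
    then obtain x where "x \<in> A - B" using BA by (metis Diff_eq_empty_iff all_not_in_conv less_irrefl subset_antisym)
    then have "insert x B \<in> indeps (uniform_matroid m A)" "insert x B \<noteq> B"
      using fin BA lt assms(1) by (auto simp: uniform_matroid_sel)
    then show False using assms(2) by (auto simp: is_basis_def)
  qed
qed

text \<open>A basis of the restriction has \<open>min m (card A)\<close> elements, which leaves room
  for \<open>m - card A\<close> more; truncated subtraction gives rank 0 once \<open>A\<close>
  spans.\<close>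

lemma contraction_uniform:
  assumes E: "finite E" and A: "A \<subseteq> E"
  shows "contraction (uniform_matroid m E) A = uniform_matroid (m - card A) (E - A)"
proof (rule matroid_eqI)
  have finA: "finite A" using A E by (rule finite_subset)
  have eq: "X \<union> B \<in> indeps (uniform_matroid m E) \<longleftrightarrow> card X \<le> m - card A"
    if X: "X \<subseteq> E - A" and B: "is_basis (restriction (uniform_matroid m E) A) B" for X B
  proof -
    have B': "B \<subseteq> A" "card B = min m (card A)"
      using B card_basis_uniform[OF finA, of m B] E A by (auto simp: restriction_uniform)
    have fin: "finite X" "finite B" using X B'(1) E finA by (auto intro: finite_subset)
    have "card (X \<union> B) = card X + card B"
      by (rule card_Un_disjoint) (use fin X B' in auto)
    then show ?thesis using E X B' A by (auto simp: uniform_matroid_sel)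
  qed
  show "indeps (contraction (uniform_matroid m E) A) = indeps (uniform_matroid (m - card A) (E - A))"
    unfolding contraction_sel using eq E is_basis_exists[of "restriction (uniform_matroid m E) A"]
    by (auto simp: uniform_matroid_sel)
qed (use E in \<open>simp add: contraction_sel uniform_matroid_sel\<close>)

lemma uniform_matroid_iso:
  assumes "finite A" "inj_on f A"
  shows "uniform_matroid m A \<simeq> uniform_matroid m (f ` A)"
proof -
  have "card (f ` X) = card X" if "X \<subseteq> A" for X
    by (rule card_image) (rule inj_on_subset[OF assms(2) that])
  then have "matroid_iso_by f (uniform_matroid m A) (uniform_matroid m (f ` A))"
    using assms by (auto simp: matroid_iso_by_def uniform_matroid_sel inj_on_imp_bij_betw)
  then show ?thesis by (auto simp: matroid_iso_def)
qed

text \<open>\<open>contains_uniform\<close> speaks of ground sets of naturals and ranks up to their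
  size; an injection into \<open>nat\<close> and truncation of the rank bridge the gap.\<close>

lemma uniform_matroid_in_class:
  assumes "contains_uniform \<M>" "finite E"
  shows "iso_class (uniform_matroid m E) \<in> \<M>"
proof -
  obtain f :: "'a \<Rightarrow> nat" where f: "inj_on f E"
    using finite_imp_inj_to_nat_seg[OF assms(2)] by metis
  define k where "k = min m (card E)"
  have k: "uniform_matroid m E = uniform_matroid k E"
    using uniform_matroid_truncate[OF assms(2), of m] by (cases "card E \<le> m") (auto simp: k_def)
  have "iso_class (uniform_matroid k (f ` E)) \<in> \<M>"
    using assms f by (auto simp: contains_uniform_def card_image k_def)
  moreover have "iso_class (uniform_matroid k E) = iso_class (uniform_matroid k (f ` E))"
    using uniform_matroid_iso[OF assms(2) f] by (simp add: iso_class_eq_iff)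
  ultimately show ?thesis by (simp add: k)
qed

lemma iso_class_uniform_eq_0_iff:
  assumes "finite E"
  shows "iso_class (uniform_matroid m E) = 0 \<longleftrightarrow> E = {}"
proof
  assume "iso_class (uniform_matroid m E) = 0"
  then obtain f where "matroid_iso_by f (uniform_matroid m E) (uniform_matroid 0 ({} :: nat set))"
    by (auto simp: zero_mclass_def iso_class_eq_iff matroid_iso_def)
  then show "E = {}"
    using assms by (auto simp: matroid_iso_by_def uniform_matroid_sel bij_betw_def)
next
  assume "E = {}"
  then show "iso_class (uniform_matroid m E) = 0"
    by (auto simp: zero_mclass_def iso_class_eq_iff matroid_iso_def matroid_iso_by_def bij_betw_def)
qed

lemma matroid_vec_uniform_empty [simp]: "\<langle>uniform_matroid m ({} :: 'a set)\<rangle> = 1"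
proof -
  have "iso_class (uniform_matroid m ({} :: 'a set)) = 0"
    by (simp add: iso_class_uniform_eq_0_iff)
  then show ?thesis by (simp add: matroid_vec_def)
qed

text \<open>Both matroids consist of loops only, or of coloops only.\<close>

lemma matroid_vec_uniform_Un:
  assumes fin: "finite A" "finite B" and dis: "A \<inter> B = {}"
    and m: "m = 0 \<or> card A + card B \<le> m"
  shows "\<langle>uniform_matroid m (A \<union> B)\<rangle> =
    \<langle>uniform_matroid m A\<rangle> * \<langle>uniform_matroid (m - card A) B\<rangle>"
proof -
  define f where "f x = (if x \<in> A then Inl x else Inr x)" for x
  let ?N = "uniform_matroid m A \<oplus> uniform_matroid (m - card A) B"
  have vim: "Inl -` f ` X = X \<inter> A" "Inr -` f ` X = X \<inter> B" if "X \<subseteq> A \<union> B" for X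
    using that dis by (auto simp: f_def image_iff split: if_splits)
  have "X \<in> indeps (uniform_matroid m (A \<union> B)) \<longleftrightarrow> f ` X \<in> indeps ?N" if X: "X \<subseteq> A \<union> B" for X
  proof -
    have finX: "finite X" using X fin by (meson finite_UnI finite_subset)
    have "X = (X \<inter> A) \<union> (X \<inter> B)" using X by blast
    then have card: "card X = card (X \<inter> A) + card (X \<inter> B)"
      using card_Un_disjoint[of "X \<inter> A" "X \<inter> B"] finX dis by auto
    have "card (X \<inter> A) \<le> card A" "card (X \<inter> B) \<le> card B"
      using fin by (auto intro: card_mono)
    \<comment> \<open>If \<open>m = 0\<close>, both sides force \<open>X\<close> to be empty;
      otherwise both hold for every \<open>X\<close>.\<close>
    then show ?thesis
      using card m X fin by (auto simp: direct_sum_sel uniform_matroid_sel vim)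
  qed
  moreover have "bij_betw f (A \<union> B) (A <+> B)"
  proof -
    have "f ` (A \<union> B) = A <+> B" using dis by (auto simp: f_def image_iff)
    moreover have "inj_on f (A \<union> B)" by (auto simp: inj_on_def f_def split: if_splits)
    ultimately show ?thesis by (simp add: bij_betw_def)
  qed
  ultimately have "uniform_matroid m (A \<union> B) \<simeq> ?N"
    unfolding matroid_iso_def matroid_iso_by_def
    using fin by (intro exI[of _ f]) (auto simp: uniform_matroid_sel direct_sum_sel)
  then have "iso_class (uniform_matroid m (A \<union> B)) = iso_class ?N"
    by (simp add: iso_class_eq_iff)
  then show ?thesis
    unfolding matroid_vec_direct_sum[symmetric] by (simp add: matroid_vec_def)
qed

text \<open>With \<open>S\<close> on the right tensor factor it acts on contractions, so unrolling
  strips off the first part of an ordered set partition. The right-hand side is the counit, which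
  detects the empty ground set.\<close>

lemma antipode_uniform_recursion:
  fixes S :: "(mclass \<Rightarrow>\<^sub>0 'k::field) \<Rightarrow> (mclass \<Rightarrow>\<^sub>0 'k)"
  assumes "contains_uniform \<M>" "is_antipode \<M> S" "finite E"
  shows "(\<Sum>A\<in>Pow E. \<langle>uniform_matroid m A\<rangle> * S \<langle>uniform_matroid (m - card A) (E - A)\<rangle>) =
    (if E = {} then 1 else 0)"
proof -
  let ?M = "uniform_matroid m E"
  have "(\<langle>?M\<rangle> :: mclass \<Rightarrow>\<^sub>0 'k) \<in> hopf_carrier \<M>"
    using uniform_matroid_in_class[OF assms(1,3)] by (simp add: hopf_carrier_def matroid_vec_def)
  then have "hopf_mult (tensor_map id S (hopf_comult \<langle>?M\<rangle>)) = hopf_unit (hopf_counit \<langle>?M\<rangle>)"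
    using assms(2) by (auto simp: is_antipode_def)
  also have "\<dots> = (if E = {} then 1 else 0)"
    using assms(3)
    by (simp add: hopf_unit_def hopf_counit_def matroid_vec_def lookup_single
        iso_class_uniform_eq_0_iff)
  also have "hopf_mult (tensor_map id S (hopf_comult \<langle>?M\<rangle>)) =
      (\<Sum>A\<in>Pow E. \<langle>uniform_matroid m A\<rangle> * S \<langle>uniform_matroid (m - card A) (E - A)\<rangle>)"
    unfolding hopf_convolution_matroid_vec
    using assms(3)
    by (intro sum.cong) (simp_all add: uniform_matroid_sel restriction_uniform contraction_uniform)
  finally show ?thesis .
qed

section \<open>Ordered set partitions as lists\<close>

text \<open>Peeling off the first part mirrors the passage to a contraction and permits induction
  over the list.\<close>

fun osp_on :: "'a set \<Rightarrow> 'a set list \<Rightarrow> bool" where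
  "osp_on E [] \<longleftrightarrow> E = {}"
| "osp_on E (B # \<pi>) \<longleftrightarrow> B \<noteq> {} \<and> B \<subseteq> E \<and> osp_on (E - B) \<pi>"

lemma osp_on_iff: "osp_on E \<pi> \<longleftrightarrow> \<pi> \<in> ordered_set_partitions E"
proof (induction \<pi> arbitrary: E)
  case Nil
  then show ?case by (auto simp: ordered_set_partitions_def partition_on_def)
next
  case (Cons B \<pi>)
  show ?case
  proof
    assume *: "osp_on E (B # \<pi>)"
    then have P: "distinct \<pi>" "partition_on (E - B) (set \<pi>)"
      using Cons.IH by (auto simp: ordered_set_partitions_def)
    then have "disjnt B (\<Union>(set \<pi>))" by (auto simp: disjnt_def partition_on_def)
    \<comment> \<open>A nonempty set disjoint from all later parts is not among them, which supplies
      distinctness.\<close>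
    moreover from this have "B \<notin> set \<pi>" using * by (auto simp: disjnt_def)
    ultimately show "B # \<pi> \<in> ordered_set_partitions E"
      using P * by (auto simp: ordered_set_partitions_def partition_on_insert)
  next
    assume *: "B # \<pi> \<in> ordered_set_partitions E"
    then have P: "distinct \<pi>" "B \<notin> set \<pi>" "partition_on E (insert B (set \<pi>))"
      by (auto simp: ordered_set_partitions_def)
    then have "disjnt B (\<Union>(set \<pi>))"
      by (fastforce simp: partition_on_def disjoint_def disjnt_def)
    then show "osp_on E (B # \<pi>)"
      using P Cons.IH by (auto simp: ordered_set_partitions_def partition_on_insert)
  qed
qed

lemma osp_on_card_pos: "osp_on E \<pi> \<Longrightarrow> finite E \<Longrightarrow> B \<in> set \<pi> \<Longrightarrow> 0 < card B"
proof (induction \<pi> arbitrary: E)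
  case (Cons A \<pi>)
  then show ?case by (auto simp: card_gt_0_iff intro: finite_subset)
qed simp

lemma osp_on_sum_card: "osp_on E \<pi> \<Longrightarrow> finite E \<Longrightarrow> (\<Sum>B\<leftarrow>\<pi>. card B) = card E"
proof (induction \<pi> arbitrary: E)
  case (Cons A \<pi>)
  then have "finite A" "card A \<le> card E" by (auto intro: finite_subset card_mono)
  then show ?case using Cons.IH[of "E - A"] Cons.prems by (simp add: card_Diff_subset)
qed simp

lemma finite_osp_on: "finite E \<Longrightarrow> finite {\<pi>. osp_on E \<pi>}"
proof -
  assume E: "finite E"
  have "{\<pi>. osp_on E \<pi>} \<subseteq> {\<pi>. set \<pi> \<subseteq> Pow E \<and> distinct \<pi>}"
    by (auto simp: osp_on_iff ordered_set_partitions_def partition_on_def)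
  moreover have "finite {\<pi>. set \<pi> \<subseteq> Pow E \<and> distinct \<pi>}"
    using E by (intro finite_subset_distinct) auto
  ultimately show ?thesis by (rule finite_subset)
qed

section \<open>Takeuchi's formula for uniform matroids\<close>

text \<open>Signed product of the minors along the chain of initial unions of parts. Truncated
  subtraction yields rank 0 once the earlier parts have at least \<open>m\<close> elements.\<close>

fun takeuchi_term :: "nat \<Rightarrow> 'a set list \<Rightarrow> (mclass \<Rightarrow>\<^sub>0 'k::field)" where
  "takeuchi_term m [] = 1"
| "takeuchi_term m (B # \<pi>) = - (\<langle>uniform_matroid m B\<rangle> * takeuchi_term (m - card B) \<pi>)"

lemma sum_osp_on_Cons:
  assumes E: "finite E" "E \<noteq> {}"
  shows "(\<Sum>\<pi> | osp_on E \<pi>. f \<pi>) = (\<Sum>B\<in>Pow E - {{}}. \<Sum>\<pi> | osp_on (E - B) \<pi>. f (B # \<pi>))"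
proof -
  have "(\<Sum>\<pi> | osp_on E \<pi>. f \<pi>) =
      (\<Sum>(B, \<pi>) \<in> (SIGMA B : Pow E - {{}}. {\<pi>. osp_on (E - B) \<pi>}). f (B # \<pi>))"
  proof (rule sum.reindex_bij_witness[of _ "\<lambda>(B, \<pi>). B # \<pi>" "\<lambda>\<pi>. (hd \<pi>, tl \<pi>)"])
    fix \<pi> assume "\<pi> \<in> {\<pi>. osp_on E \<pi>}"
    then show "(case (hd \<pi>, tl \<pi>) of (B, \<pi>) \<Rightarrow> B # \<pi>) = \<pi>"
      "(hd \<pi>, tl \<pi>) \<in> (SIGMA B : Pow E - {{}}. {\<pi>. osp_on (E - B) \<pi>})"
      "(case (hd \<pi>, tl \<pi>) of (B, \<pi>) \<Rightarrow> f (B # \<pi>)) = f \<pi>"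
      using E(2) by (cases \<pi>; auto)+
  qed auto
  also have "\<dots> = (\<Sum>B\<in>Pow E - {{}}. \<Sum>\<pi> | osp_on (E - B) \<pi>. f (B # \<pi>))"
    by (rule sum.Sigma[symmetric]) (use E in \<open>auto intro: finite_osp_on\<close>)
  finally show ?thesis .
qed

lemma antipode_uniform_takeuchi:
  fixes E :: "'a set"
  assumes M: "contains_uniform \<M>" and S: "is_antipode \<M> S" and E: "finite E"
  shows "S \<langle>uniform_matroid m E\<rangle> = (\<Sum>\<pi> | osp_on E \<pi>. takeuchi_term m \<pi>)"
  using E
proof (induction E arbitrary: m rule: finite_psubset_induct)
  case (psubset E)
  let ?g = "\<lambda>A. \<langle>uniform_matroid m A\<rangle> * S \<langle>uniform_matroid (m - card A) (E - A)\<rangle>"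
  have rec: "(\<Sum>A\<in>Pow E. ?g A) = (if E = {} then 1 else 0)"
    by (rule antipode_uniform_recursion[OF M S psubset.hyps])
  show ?case
  proof (cases "E = {}")
    case True
    have "{\<pi> :: 'a set list. osp_on {} \<pi>} = {[]}"
      by (auto simp: osp_on_iff ordered_set_partitions_def partition_on_empty)
    then show ?thesis using rec True by simp
  next
    case False
    have "(\<Sum>\<pi> | osp_on E \<pi>. takeuchi_term m \<pi>) = (\<Sum>A\<in>Pow E - {{}}. - ?g A)"
      unfolding sum_osp_on_Cons[OF psubset.hyps False]
    proof (rule sum.cong[OF refl])
      fix A assume "A \<in> Pow E - {{}}"
      then have "E - A \<subset> E" by auto
      then show "(\<Sum>\<pi> | osp_on (E - A) \<pi>. takeuchi_term m (A # \<pi>)) = - ?g A"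
        by (simp add: psubset.IH sum_negf sum_distrib_left)
    qed
    \<comment> \<open>The empty subset contributes 1 times \<open>S\<close> of the whole matroid;
      isolating it solves the recursion for that value.\<close>
    also have "(\<Sum>A\<in>Pow E - {{}}. - ?g A) = ?g {} - (\<Sum>A\<in>Pow E. ?g A)"
      using psubset.hyps by (simp add: sum_diff1 sum_negf)
    also have "\<dots> = S \<langle>uniform_matroid m E\<rangle>"
      using rec False by simp
    finally show ?thesis by simp
  qed
qed

section \<open>Takeuchi terms expressed through the pair of \<open>I\<close> and
  \<open>L\<close>\<close>

lemma osp_sgn_simps [simp]: "osp_sgn [] = 1" "osp_sgn (B # \<pi>) = - osp_sgn \<pi>"
  by (simp_all add: osp_sgn_def)

text \<open>A uniform matroid of rank 0 consists of loops, so it is the direct sum over any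
  partition of its ground set and only the sign remembers the parts. This absorbs everything after
  the critical part.\<close>

lemma takeuchi_term_0:
  assumes "osp_on E \<pi>" "finite E"
  shows "(takeuchi_term 0 \<pi> :: mclass \<Rightarrow>\<^sub>0 'k::field) = osp_sgn \<pi> * \<langle>uniform_matroid 0 E\<rangle>"
  using assms
proof (induction \<pi> arbitrary: E)
  case (Cons B \<pi>)
  then have "finite B" "B \<union> (E - B) = E" by (auto intro: finite_subset)
  then have "(\<langle>uniform_matroid 0 E\<rangle> :: mclass \<Rightarrow>\<^sub>0 'k) =
      \<langle>uniform_matroid 0 B\<rangle> * \<langle>uniform_matroid 0 (E - B)\<rangle>"
    using matroid_vec_uniform_Un[of B "E - B" 0] Cons.prems by simp
  then show ?case
    using Cons.IH[of "E - B"] Cons.prems by (simp add: mult.left_commute)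
qed simp

lemma size_upto_Cons:
  "size_upto (B # \<pi>) 0 = card B" "size_upto (B # \<pi>) (Suc i) = card B + size_upto \<pi> i"
  by (simp_all add: size_upto_def)

lemma crit_index_exists:
  assumes "m \<le> (\<Sum>B\<leftarrow>\<pi>. card B)"
  shows "m \<le> size_upto \<pi> (crit_index m \<pi>)"
  unfolding crit_index_def
  \<comment> \<open>The index \<open>length \<pi>\<close> lies past the last part but still yields
    the full sum, also for the empty list.\<close>
  by (rule LeastI[of _ "length \<pi>"]) (use assms in \<open>simp add: size_upto_def\<close>)

lemma crit_index_Cons_0: "m \<le> card B \<Longrightarrow> crit_index m (B # \<pi>) = 0"
  by (simp add: crit_index_def size_upto_Cons Least_eq_0)

text \<open>\<open>B\<close> alone stays below \<open>m\<close>, which excludes index 0; the second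
  bound guarantees that the tail reaches the rest.\<close>

lemma crit_index_Cons_Suc:
  assumes "card B < m" "m - card B \<le> (\<Sum>B\<leftarrow>\<pi>. card B)"
  shows "crit_index m (B # \<pi>) = Suc (crit_index (m - card B) \<pi>)"
proof -
  have "m \<le> size_upto (B # \<pi>) (Suc (crit_index (m - card B) \<pi>))"
    using crit_index_exists[OF assms(2)] by (simp add: size_upto_Cons)
  then have "crit_index m (B # \<pi>) = Suc (LEAST i. m \<le> size_upto (B # \<pi>) (Suc i))"
    unfolding crit_index_def[of m]
    by (rule Least_Suc) (use assms(1) in \<open>simp add: size_upto_Cons\<close>)
  also have "(LEAST i. m \<le> size_upto (B # \<pi>) (Suc i)) = crit_index (m - card B) \<pi>"
    unfolding crit_index_def size_upto_Cons by (rule arg_cong[of _ _ Least]) auto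
  finally show ?thesis .
qed

lemma crit_part_Cons:
  "m \<le> card B \<Longrightarrow> crit_part m (B # \<pi>) = B"
  "card B < m \<Longrightarrow> m - card B \<le> (\<Sum>B\<leftarrow>\<pi>. card B) \<Longrightarrow>
     crit_part m (B # \<pi>) = crit_part (m - card B) \<pi>"
  by (simp_all add: crit_part_def crit_index_Cons_0 crit_index_Cons_Suc)

lemma initial_part_Cons:
  "m \<le> card B \<Longrightarrow> initial_part m (B # \<pi>) = {}"
  "card B < m \<Longrightarrow> m - card B \<le> (\<Sum>B\<leftarrow>\<pi>. card B) \<Longrightarrow>
     initial_part m (B # \<pi>) = B \<union> initial_part (m - card B) \<pi>"
  by (simp_all add: initial_part_def crit_index_Cons_0 crit_index_Cons_Suc)

lemma initial_part_subset: "osp_on E \<pi> \<Longrightarrow> initial_part m \<pi> \<subseteq> E"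
  unfolding osp_on_iff initial_part_def ordered_set_partitions_def partition_on_def
  using set_take_subset by fastforce

text \<open>Parts before the critical one are free and join to the summand on \<open>I\<close>, the
  critical part takes the remaining rank, and the later parts join to the loops of the third
  summand. In the induction, \<open>B\<close> is either critical or the next piece of
  \<open>I\<close>.\<close>

lemma takeuchi_term_eq:
  assumes "osp_on E \<pi>" "finite E" "m \<le> card E"
  shows "(takeuchi_term m \<pi> :: mclass \<Rightarrow>\<^sub>0 'k::field) = osp_sgn \<pi> *
    (let I = initial_part m \<pi>; L = crit_part m \<pi>
     in \<langle>uniform_matroid (card I) I \<oplus> uniform_matroid (m - card I) L
         \<oplus> uniform_matroid 0 (E - (I \<union> L))\<rangle>)"
  using assms
proof (induction \<pi> arbitrary: E m)
  case Nil
  then show ?case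
    by (simp add: initial_part_def crit_part_def matroid_vec_direct_sum)
next
  case (Cons B \<pi>)
  have B: "B \<subseteq> E" "osp_on (E - B) \<pi>" "finite B"
    using Cons.prems by (auto intro: finite_subset)
  show ?case
  proof (cases "m \<le> card B")
    case True
    then show ?thesis
      using Cons.prems(2)
      by (simp add: takeuchi_term_0[OF B(2)] crit_part_Cons initial_part_Cons matroid_vec_direct_sum
          mult.left_commute)
  next
    case False
    define I where "I = initial_part (m - card B) \<pi>"
    define L where "L = crit_part (m - card B) \<pi>"
    have le: "m - card B \<le> card (E - B)"
      using Cons.prems B by (simp add: card_Diff_subset)
    then have le': "m - card B \<le> (\<Sum>B\<leftarrow>\<pi>. card B)"
      using osp_on_sum_card[OF B(2)] Cons.prems by simp
    have parts: "initial_part m (B # \<pi>) = B \<union> I" "crit_part m (B # \<pi>) = L"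
      using False le' by (simp_all add: crit_part_Cons initial_part_Cons I_def L_def)
    have I: "I \<subseteq> E - B" unfolding I_def by (rule initial_part_subset[OF B(2)])
    then have finI: "finite I" using Cons.prems(2) by (meson finite_Diff finite_subset)
    have dis: "B \<inter> I = {}" using I by blast
    have card: "card (B \<union> I) = card B + card I"
      by (rule card_Un_disjoint) (use B(3) finI dis in auto)
    have "(takeuchi_term (m - card B) \<pi> :: mclass \<Rightarrow>\<^sub>0 'k) = osp_sgn \<pi> * (\<langle>uniform_matroid (card I) I\<rangle> *
        \<langle>uniform_matroid (m - card B - card I) L\<rangle> * \<langle>uniform_matroid 0 (E - B - (I \<union> L))\<rangle>)"
      using Cons.IH[OF B(2) _ le] Cons.prems(2)
      by (simp add: I_def L_def Let_def matroid_vec_direct_sum)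
    \<comment> \<open>\<open>B\<close> is free, so its rank can be raised or lowered to the value at
      which it joins with \<open>I\<close>.\<close>
    moreover have "uniform_matroid m B = uniform_matroid (card B + card I) B"
      using False B(3) uniform_matroid_truncate[of B m]
        uniform_matroid_truncate[of B "card B + card I"] by simp
    moreover have "E - B - (I \<union> L) = E - (B \<union> I \<union> L)" by blast
    ultimately show ?thesis
      by (simp add: matroid_vec_uniform_Un[OF B(3) finI dis, of "card B + card I"] parts card matroid_vec_direct_sum algebra_simps)
  qed
qed

section \<open>The sign-reversing involution\<close>

lemma order_max_eqI:
  assumes "linear_order_on E r" "x \<in> B" "\<And>y. y \<in> B \<Longrightarrow> (y, x) \<in> r"
  shows "order_max r B = x"
  unfolding order_max_def
proof (rule the_equality)
  fix y assume "y \<in> B \<and> (\<forall>z\<in>B. (z, y) \<in> r)"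
  then show "y = x"
    using assms(2,3) antisymD[of r y x] assms(1)
    by (simp add: linear_order_on_def partial_order_on_def)
qed (use assms in blast)

lemma order_max_properties:
  assumes r: "linear_order_on E r" and B: "B \<subseteq> E" "finite B" "B \<noteq> {}"
  shows "order_max r B \<in> B" "\<And>y. y \<in> B \<Longrightarrow> (y, order_max r B) \<in> r"
proof -
  have tr: "trans r" and re: "refl_on E r" and tot: "total_on E r"
    using r by (auto simp: linear_order_on_def partial_order_on_def preorder_on_def)
  have "\<exists>x\<in>B. \<forall>y\<in>B. (y, x) \<in> r"
    using B(2,3,1)
  proof (induction B rule: finite_ne_induct)
    case (singleton x)
    then show ?case using re by (auto dest: refl_onD)
  next
    case (insert x F)
    then obtain z where z: "z \<in> F" "\<forall>y\<in>F. (y, z) \<in> r" by auto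
    have E: "x \<in> E" "z \<in> E" using insert.prems z by auto
    have xx: "(x, x) \<in> r" using re E by (auto dest: refl_onD)
    show ?case
    proof (cases "(x, z) \<in> r")
      case True
      then show ?thesis using z by auto
    next
      case False
      \<comment> \<open>Totality compares distinct elements only; \<open>xx\<close> excludes
        \<open>x = z\<close>.\<close>
      then have "(z, x) \<in> r" using tot E xx by (auto simp: total_on_def)
      then have "(y, x) \<in> r" if "y \<in> F" for y
        using z that by (blast intro: transD[OF tr])
      then show ?thesis using xx by auto
    qed
  qed
  then obtain x where x: "x \<in> B" "\<forall>y\<in>B. (y, x) \<in> r" by blast
  have "order_max r B = x"
    using order_max_eqI[OF r] x by blast
  then show "order_max r B \<in> B" "\<And>y. y \<in> B \<Longrightarrow> (y, order_max r B) \<in> r"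
    using x by auto
qed

text \<open>A part of size \<open>k\<close> preceded by \<open>s\<close> elements is frozen if it is the critical part and
  the ordered set partition is not exact. Two adjacent parts may be merged only if the
  resulting part is not frozen, which makes all conditions on positions local.\<close>

definition frozen :: "nat \<Rightarrow> nat \<Rightarrow> nat \<Rightarrow> bool" where
  "frozen m s k \<longleftrightarrow> s < m \<and> m < s + k \<or> m = 0 \<and> s = 0"

definition splittable :: "nat \<Rightarrow> nat \<Rightarrow> 'a set \<Rightarrow> bool" where
  "splittable m s B \<longleftrightarrow> 1 < card B \<and> \<not> frozen m s (card B)"

fun mergeable :: "('a \<times> 'a) set \<Rightarrow> nat \<Rightarrow> nat \<Rightarrow> 'a set \<Rightarrow> 'a set list \<Rightarrow> bool" where
  "mergeable r m s B [] \<longleftrightarrow> False"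
| "mergeable r m s B (C # \<pi>) \<longleftrightarrow> card B = 1 \<and> \<not> frozen m s (card B + card C) \<and>
     (\<forall>x\<in>B. \<forall>y\<in>C. (y, x) \<in> r \<and> y \<noteq> x)"

text \<open>The counter \<open>s\<close> of elements already passed replaces list positions, so the
  recursion can enter the tail without reference to the critical index of the whole list.\<close>

fun flip :: "('a \<times> 'a) set \<Rightarrow> nat \<Rightarrow> nat \<Rightarrow> 'a set list \<Rightarrow> 'a set list" where
  "flip r m s [] = []"
| "flip r m s (B # \<pi>) =
     (if splittable m s B then {order_max r B} # (B - {order_max r B}) # \<pi>
      else if mergeable r m s B \<pi> then (B \<union> hd \<pi>) # tl \<pi>
      else B # flip r m (s + card B) \<pi>)"

lemma mergeable_obtain:
  assumes "mergeable r m s B \<pi>"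
  obtains b C \<pi>' where "B = {b}" "\<pi> = C # \<pi>'" "\<not> frozen m s (1 + card C)"
    "\<forall>y\<in>C. (y, b) \<in> r" "b \<notin> C"
proof (cases \<pi>)
  case (Cons C \<pi>')
  with assms obtain b where "B = {b}" by (auto simp: card_1_singleton_iff)
  with assms Cons show thesis by (intro that[of b C \<pi>']) auto
qed (use assms in simp)

lemma splittable_obtain:
  assumes "splittable m s B" "linear_order_on E r" "B \<subseteq> E"
  obtains b C where "order_max r B = b" "B = insert b C" "b \<notin> C" "C \<noteq> {}" "finite C"
    "B - {b} = C" "\<forall>y\<in>C. (y, b) \<in> r" "\<not> frozen m s (1 + card C)"
proof -
  \<comment> \<open>Finiteness comes from the positive cardinality, as infinite sets have
    \<open>card\<close> 0.\<close>
  have B: "finite B" "B \<noteq> {}" "1 < card B" "\<not> frozen m s (card B)"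
    using assms(1) card_gt_0_iff[of B] by (auto simp: splittable_def)
  note mx = order_max_properties[OF assms(2,3) B(1,2)]
  have "card B = 1 + card (B - {order_max r B})"
    using mx(1) B(1,3) by (simp add: card_Diff_singleton)
  moreover from this have "B - {order_max r B} \<noteq> {}"
    using B(3) by force
  ultimately show thesis
    using B mx by (intro that[of "order_max r B" "B - {order_max r B}"]) auto
qed

text \<open>The order stays on a fixed set \<open>F\<close> while \<open>E\<close> shrinks along the
  induction.\<close>

lemma flip_osp_on:
  assumes "osp_on E \<pi>" "linear_order_on F r" "E \<subseteq> F"
  shows "osp_on E (flip r m s \<pi>)"
  using assms(1,3)
proof (induction \<pi> arbitrary: E s)
  case (Cons B \<pi>)
  have B: "B \<noteq> {}" "B \<subseteq> E" "osp_on (E - B) \<pi>" using Cons.prems by auto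
  consider "splittable m s B" | "\<not> splittable m s B" "mergeable r m s B \<pi>"
    | "\<not> splittable m s B" "\<not> mergeable r m s B \<pi>" by blast
  then show ?case
  proof cases
    case 1
    have "B \<subseteq> F" using B Cons.prems by auto
    from splittable_obtain[OF 1 assms(2) this] obtain b C where
      bC: "order_max r B = b" "B = insert b C" "b \<notin> C" "C \<noteq> {}" "finite C"
        "B - {b} = C" "\<forall>y\<in>C. (y, b) \<in> r" "\<not> frozen m s (1 + card C)" .
    have "E - {b} - C = E - B" using bC by auto
    then show ?thesis using 1 B bC by auto
  next
    case 2
    from mergeable_obtain[OF 2(2)] obtain b C \<pi>' where
      bC: "B = {b}" "\<pi> = C # \<pi>'" "\<not> frozen m s (1 + card C)"
        "\<forall>y\<in>C. (y, b) \<in> r" "b \<notin> C" .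
    have "E - B - C = E - (B \<union> C)" by auto
    then show ?thesis using 2 B bC by auto
  next
    case 3
    have "E - B \<subseteq> F" using Cons.prems by auto
    then show ?thesis using 3 B Cons.IH[OF B(3)] by auto
  qed
qed simp

lemma mergeable_flip:
  assumes b: "b \<in> F" "b \<notin> E" and \<pi>: "osp_on E \<pi>" and r: "linear_order_on F r"
    and E: "E \<subseteq> F" and F: "finite F"
  shows "mergeable r m s {b} (flip r m (Suc s) \<pi>) \<longleftrightarrow> mergeable r m s {b} \<pi>"
proof (cases \<pi>)
  case (Cons C \<pi>')
  have tr: "\<And>x y z. (x, y) \<in> r \<Longrightarrow> (y, z) \<in> r \<Longrightarrow> (x, z) \<in> r"
    using r by (auto simp: linear_order_on_def partial_order_on_def preorder_on_def dest: transD)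
  have C: "C \<noteq> {}" "C \<subseteq> E" "osp_on (E - C) \<pi>'" using \<pi> Cons by auto
  \<comment> \<open>Given the premise, the only value of \<open>m\<close> strictly between
    \<open>s\<close> and \<open>s + 1 + k\<close> is \<open>s + 1\<close>, whatever the positive
    \<open>k\<close>.\<close>
  have two: "frozen m s (Suc (Suc 0)) \<longleftrightarrow> frozen m s (Suc k)"
    if "\<not> frozen m (Suc s) k" "0 < k" for k
    using that by (auto simp: frozen_def)
  consider "splittable m (Suc s) C"
    | "\<not> splittable m (Suc s) C" "mergeable r m (Suc s) C \<pi>'"
    | "\<not> splittable m (Suc s) C" "\<not> mergeable r m (Suc s) C \<pi>'" by blast
  then show ?thesis
  proof cases
    case 1
    have "C \<subseteq> F" using C E by auto
    from splittable_obtain[OF 1 r this] obtain c D where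
      D: "order_max r C = c" "C = insert c D" "c \<notin> D" "D \<noteq> {}" "finite D"
        "C - {c} = D" "\<forall>y\<in>D. (y, c) \<in> r" "\<not> frozen m (Suc s) (1 + card D)" .
    have "frozen m s (Suc (Suc 0)) \<longleftrightarrow> frozen m s (Suc (card C))"
      using D two[of "Suc (card D)"] by simp
    then show ?thesis
      using 1 D b C Cons by (auto intro: tr)
  next
    case 2
    from mergeable_obtain[OF 2(2)] obtain c D \<pi>'' where
      D: "C = {c}" "\<pi>' = D # \<pi>''" "\<not> frozen m (Suc s) (1 + card D)"
        "\<forall>y\<in>D. (y, c) \<in> r" "c \<notin> D" .
    have "D \<subseteq> E" using C D by auto
    then have fin: "finite D" using E F by (meson finite_subset)
    have "frozen m s (Suc (Suc 0)) \<longleftrightarrow> frozen m s (Suc (Suc (card D)))"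
      using D two[of "Suc (card D)"] by simp
    then show ?thesis
      using 2 D b C Cons fin \<open>D \<subseteq> E\<close> by (auto intro: tr simp: card_insert_if)
  next
    case 3
    then show ?thesis using Cons by simp
  qed
qed simp

text \<open>A split leaves a singleton maximum that merges back, and a merge puts its singleton on
  top of the union, where it is split off again. A part passed over is passed over again by
  \<open>mergeable_flip\<close>.\<close>

lemma flip_flip:
  assumes "osp_on E \<pi>" "linear_order_on F r" "E \<subseteq> F" "finite F"
  shows "flip r m s (flip r m s \<pi>) = \<pi>"
  using assms(1,3)
proof (induction \<pi> arbitrary: E s)
  case (Cons B \<pi>)
  have B: "B \<noteq> {}" "B \<subseteq> E" "osp_on (E - B) \<pi>" "B \<subseteq> F" "E - B \<subseteq> F"
    using Cons.prems by auto
  consider "splittable m s B" | "\<not> splittable m s B" "mergeable r m s B \<pi>"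
    | "\<not> splittable m s B" "\<not> mergeable r m s B \<pi>" by blast
  then show ?case
  proof cases
    case 1
    from splittable_obtain[OF 1 assms(2) B(4)] obtain b C where
      bC: "order_max r B = b" "B = insert b C" "b \<notin> C" "C \<noteq> {}" "finite C"
        "B - {b} = C" "\<forall>y\<in>C. (y, b) \<in> r" "\<not> frozen m s (1 + card C)" .
    have "flip r m s (B # \<pi>) = {b} # C # \<pi>" using 1 bC by simp
    moreover have "\<not> splittable m s {b}" "mergeable r m s {b} (C # \<pi>)"
      using bC by (auto simp: splittable_def)
    ultimately show ?thesis using bC by simp
  next
    case 2
    from mergeable_obtain[OF 2(2)] obtain b C \<pi>' where
      bC: "B = {b}" "\<pi> = C # \<pi>'" "\<not> frozen m s (1 + card C)"
        "\<forall>y\<in>C. (y, b) \<in> r" "b \<notin> C" .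
    have "C \<noteq> {}" "C \<subseteq> F" using B bC by auto
    then have C: "C \<noteq> {}" "finite C" using assms(4) finite_subset by auto
    have "(b, b) \<in> r"
      using assms(2) B(4) bC(1)
      by (auto simp: linear_order_on_def partial_order_on_def preorder_on_def dest: refl_onD)
    then have mx: "order_max r (insert b C) = b"
      using order_max_eqI[OF assms(2), of b "insert b C"] bC by auto
    have "splittable m s (insert b C)"
      using bC C by (simp add: splittable_def card_gt_0_iff)
    then show ?thesis using 2 bC mx by simp
  next
    case 3
    have IH: "flip r m (s + card B) (flip r m (s + card B) \<pi>) = \<pi>"
      by (rule Cons.IH[OF B(3,5)])
    have "\<not> mergeable r m s B (flip r m (s + card B) \<pi>)"
    proof
      assume *: "mergeable r m s B (flip r m (s + card B) \<pi>)"
      then obtain b where "B = {b}" by (rule mergeable_obtain)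
      then show False
        using * 3(2) mergeable_flip[of b F "E - B" \<pi> r m s] B assms(2,4) by auto
    qed
    then show ?thesis using 3 IH by simp
  qed
qed simp

lemma takeuchi_term_flip:
  assumes "osp_on E \<pi>" "linear_order_on F r" "E \<subseteq> F" "finite F" "flip r m s \<pi> \<noteq> \<pi>"
  shows "(takeuchi_term (m - s) (flip r m s \<pi>) :: mclass \<Rightarrow>\<^sub>0 'k::field) =
      - takeuchi_term (m - s) \<pi> \<and>
    even (length (flip r m s \<pi>)) \<noteq> even (length \<pi>)"
  using assms(1,3,5)
proof (induction \<pi> arbitrary: E s)
  case (Cons B \<pi>)
  have B: "B \<noteq> {}" "B \<subseteq> E" "osp_on (E - B) \<pi>" "B \<subseteq> F" "E - B \<subseteq> F"
    using Cons.prems by auto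
  \<comment> \<open>After \<open>s\<close> elements the remaining rank is \<open>m - s\<close>. Not
    being frozen means that it is 0 or at least \<open>1 + card C\<close>: the cases of loops and of
    coloops.\<close>
  have U: "(\<langle>uniform_matroid (m - s) (insert b C)\<rangle> :: mclass \<Rightarrow>\<^sub>0 'k) =
      \<langle>uniform_matroid (m - s) {b}\<rangle> * \<langle>uniform_matroid (m - s - 1) C\<rangle>"
    if "b \<notin> C" "finite C" "\<not> frozen m s (1 + card C)" for b and C :: "'a set"
    using matroid_vec_uniform_Un[of "{b}" C "m - s"] that by (auto simp: frozen_def)
  consider "splittable m s B" | "\<not> splittable m s B" "mergeable r m s B \<pi>"
    | "\<not> splittable m s B" "\<not> mergeable r m s B \<pi>" by blast
  then show ?case
  proof cases
    case 1
    from splittable_obtain[OF 1 assms(2) B(4)] obtain b C where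
      bC: "order_max r B = b" "B = insert b C" "b \<notin> C" "C \<noteq> {}" "finite C"
        "B - {b} = C" "\<forall>y\<in>C. (y, b) \<in> r" "\<not> frozen m s (1 + card C)" .
    have "flip r m s (B # \<pi>) = {b} # C # \<pi>" using 1 bC by simp
    then show ?thesis using bC U[OF bC(3,5,8)] by (simp add: mult.assoc)
  next
    case 2
    from mergeable_obtain[OF 2(2)] obtain b C \<pi>' where
      bC: "B = {b}" "\<pi> = C # \<pi>'" "\<not> frozen m s (1 + card C)"
        "\<forall>y\<in>C. (y, b) \<in> r" "b \<notin> C" .
    have "C \<subseteq> F" using B bC by auto
    then have C: "finite C" using assms(4) by (rule finite_subset)
    have "flip r m s (B # \<pi>) = insert b C # \<pi>'" using 2 bC by simp
    then show ?thesis using bC C U[OF bC(5) C bC(3)] by (simp add: mult.assoc)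
  next
    case 3
    then have "flip r m (s + card B) \<pi> \<noteq> \<pi>" using Cons.prems(3) by simp
    from Cons.IH[OF B(3,5) this] show ?thesis using 3 by simp
  qed
qed simp

text \<open>The moved partitions are divided by parity of length and \<open>flip\<close> exchanges
  the two halves. This cancels in every characteristic, whereas a sum equal to its own negative need
  not vanish in characteristic 2.\<close>

lemma sum_takeuchi_term_fixed:
  assumes r: "linear_order_on E r" and E: "finite E"
  shows "(\<Sum>\<pi> | osp_on E \<pi>. takeuchi_term m \<pi> :: mclass \<Rightarrow>\<^sub>0 'k::field) =
    (\<Sum>\<pi> | osp_on E \<pi> \<and> flip r m 0 \<pi> = \<pi>. takeuchi_term m \<pi>)"
proof -
  define f where "f = flip r m 0"
  define t :: "'a set list \<Rightarrow> mclass \<Rightarrow>\<^sub>0 'k" where "t = takeuchi_term m"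
  define X where "X p = {\<pi>. osp_on E \<pi> \<and> f \<pi> \<noteq> \<pi> \<and> even (length \<pi>) = p}" for p
  have osp: "osp_on E (f \<pi>)" if "osp_on E \<pi>" for \<pi>
    unfolding f_def by (rule flip_osp_on[OF that r]) simp
  have inv: "f (f \<pi>) = \<pi>" if "osp_on E \<pi>" for \<pi>
    unfolding f_def by (rule flip_flip[OF that r _ E]) simp
  have neg: "t (f \<pi>) = - t \<pi>" "even (length (f \<pi>)) \<noteq> even (length \<pi>)"
    if "osp_on E \<pi>" "f \<pi> \<noteq> \<pi>" for \<pi>
    using takeuchi_term_flip[OF that(1) r order_refl E, of m 0] that(2)
    by (auto simp: f_def t_def)
  have fin: "finite {\<pi>. osp_on E \<pi> \<and> Q \<pi>}" for Q
    by (rule finite_subset[OF _ finite_osp_on[OF E]]) auto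
  have finX: "finite (X p)" for p unfolding X_def by (rule fin)
  have "sum t (X False) = (\<Sum>\<pi>\<in>X True. - t \<pi>)"
    by (rule sum.reindex_bij_witness[of _ f f])
       (use neg inv osp in \<open>auto simp: X_def\<close>)
  then have cancel: "sum t (X True) + sum t (X False) = 0"
    by (simp add: sum_negf)
  have "{\<pi>. osp_on E \<pi>} = {\<pi>. osp_on E \<pi> \<and> f \<pi> = \<pi>} \<union> (X True \<union> X False)"
    by (auto simp: X_def)
  then have "sum t {\<pi>. osp_on E \<pi>} = sum t ({\<pi>. osp_on E \<pi> \<and> f \<pi> = \<pi>} \<union> (X True \<union> X False))"
    by simp
  also have "\<dots> = sum t {\<pi>. osp_on E \<pi> \<and> f \<pi> = \<pi>} + sum t (X True \<union> X False)"
    by (rule sum.union_disjoint[OF fin finite_UnI[OF finX finX]]) (auto simp: X_def)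
  also have "sum t (X True \<union> X False) = sum t (X True) + sum t (X False)"
    by (rule sum.union_disjoint[OF finX finX]) (auto simp: X_def)
  finally show ?thesis using cancel by (simp add: t_def f_def)
qed

section \<open>Fixed points\<close>

text \<open>Unlike \<open>size_upto\<close> this excludes part \<open>i\<close>: it is the counter
  with which \<open>flip\<close> started at 0 arrives there.\<close>

definition prefix_size :: "'a set list \<Rightarrow> nat \<Rightarrow> nat" where
  "prefix_size \<pi> i = (\<Sum>B\<leftarrow>take i \<pi>. card B)"

lemma prefix_size_simps [simp]:
  "prefix_size \<pi> 0 = 0" "prefix_size (B # \<pi>) (Suc i) = card B + prefix_size \<pi> i"
  by (simp_all add: prefix_size_def)

lemma flip_eq_iff:
  "flip r m s \<pi> = \<pi> \<longleftrightarrow> (\<forall>i<length \<pi>. \<not> splittable m (s + prefix_size \<pi> i) (\<pi> ! i) \<and>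
     \<not> mergeable r m (s + prefix_size \<pi> i) (\<pi> ! i) (drop (Suc i) \<pi>))"
proof (induction \<pi> arbitrary: s)
  case (Cons B \<pi>)
  have "mergeable r m s B \<pi> \<Longrightarrow> (B \<union> hd \<pi>) # tl \<pi> \<noteq> B # \<pi>"
    by (cases \<pi>) (auto dest: arg_cong[of _ _ length])
  moreover have "{order_max r B} # (B - {order_max r B}) # \<pi> \<noteq> B # \<pi>"
    by (auto dest: arg_cong[of _ _ length])
  ultimately show ?case
    using Cons.IH[of "s + card B"] by (auto simp: All_less_Suc2 add.assoc)
qed simp

text \<open>Replaces the least index by a window of prefix sizes. Index 0 is exempt from the strict
  bound because the first part is critical even for \<open>m = 0\<close>.\<close>

lemma crit_index_iff:
  assumes "m \<le> (\<Sum>B\<leftarrow>\<pi>. card B)"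
  shows "i = crit_index m \<pi> \<longleftrightarrow> m \<le> prefix_size \<pi> (Suc i) \<and> (i = 0 \<or> prefix_size \<pi> i < m)"
proof -
  have mono: "prefix_size \<pi> j \<le> prefix_size \<pi> k" if "j \<le> k" for j k
    using that by (auto simp: prefix_size_def le_iff_add take_add)
  have eq: "size_upto \<pi> j = prefix_size \<pi> (Suc j)" for j
    by (simp add: size_upto_def prefix_size_def)
  have c: "m \<le> prefix_size \<pi> (Suc (crit_index m \<pi>))"
    using crit_index_exists[OF assms] by (simp add: eq)
  have least: "prefix_size \<pi> (Suc j) < m" if "j < crit_index m \<pi>" for j
    using not_less_Least[of j "\<lambda>i. m \<le> size_upto \<pi> i"] that by (auto simp: crit_index_def eq)
  show ?thesis
  proof
    assume "i = crit_index m \<pi>"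
    then show "m \<le> prefix_size \<pi> (Suc i) \<and> (i = 0 \<or> prefix_size \<pi> i < m)"
      using c least[of "i - 1"] by (cases i) auto
  next
    assume i: "m \<le> prefix_size \<pi> (Suc i) \<and> (i = 0 \<or> prefix_size \<pi> i < m)"
    show "i = crit_index m \<pi>"
    proof (rule antisym)
      show "i \<le> crit_index m \<pi>"
      proof (rule ccontr)
        assume "\<not> ?thesis"
        then show False using mono[of "Suc (crit_index m \<pi>)" i] c i by auto
      qed
      show "crit_index m \<pi> \<le> i" using least[of i] i by fastforce
    qed
  qed
qed

text \<open>A frozen part is a critical one whose upper bound is strict. For \<open>m = 0\<close>
  the critical part is the first; positive sizes make it inexact and the only one with prefix size
  0.\<close>

lemma frozen_iff:
  assumes "m \<le> (\<Sum>B\<leftarrow>\<pi>. card B)" "\<And>B. B \<in> set \<pi> \<Longrightarrow> 0 < card B" "i < length \<pi>"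
  shows "frozen m (prefix_size \<pi> i) (card (\<pi> ! i)) \<longleftrightarrow> \<not> exact m \<pi> \<and> i = crit_index m \<pi>"
proof -
  have ex: "exact m \<pi> \<longleftrightarrow> prefix_size \<pi> (Suc i) = m" if "i = crit_index m \<pi>"
    by (simp add: that exact_def size_upto_def prefix_size_def)
  have suc: "prefix_size \<pi> (Suc i) = prefix_size \<pi> i + card (\<pi> ! i)"
    using assms(3) by (simp add: prefix_size_def take_Suc_conv_app_nth)
  have pos: "0 < card (\<pi> ! i)" using assms(2,3) by simp
  have "prefix_size \<pi> i = 0 \<longleftrightarrow> i = 0"
    using assms(2,3) by (cases \<pi>; cases i) auto
  then show ?thesis
    using ex crit_index_iff[OF assms(1), of i] suc pos by (auto simp: frozen_def)
qed

text \<open>With \<open>m\<close> strictly inside the union of a singleton and its successor, either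
  \<open>m\<close> is the boundary between them and part \<open>i\<close> is critical, or
  \<open>m\<close> is strictly inside the successor. The case \<open>m = 0\<close> concerns
  \<open>i = 0\<close>. These are the two exclusions in \<open>can_merge\<close>.\<close>

lemma frozen_merge_iff:
  assumes "m \<le> (\<Sum>B\<leftarrow>\<pi>. card B)" "\<And>B. B \<in> set \<pi> \<Longrightarrow> 0 < card B" "Suc i < length \<pi>"
    and "card (\<pi> ! i) = 1"
  shows "frozen m (prefix_size \<pi> i) (1 + card (\<pi> ! Suc i)) \<longleftrightarrow>
    i = crit_index m \<pi> \<or> \<not> exact m \<pi> \<and> Suc i = crit_index m \<pi>"
proof -
  have suc: "prefix_size \<pi> (Suc i) = prefix_size \<pi> i + 1"
    using assms(3,4) by (simp add: prefix_size_def take_Suc_conv_app_nth)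
  have pos: "0 < card (\<pi> ! Suc i)" using assms(2,3) by simp
  have "prefix_size \<pi> i = 0 \<longleftrightarrow> i = 0"
    using assms(2,3) by (cases \<pi>; cases i) auto
  moreover have "frozen m (prefix_size \<pi> (Suc i)) (card (\<pi> ! Suc i)) \<longleftrightarrow>
      \<not> exact m \<pi> \<and> Suc i = crit_index m \<pi>"
    by (rule frozen_iff[OF assms(1-3)])
  ultimately show ?thesis
    using crit_index_iff[OF assms(1), of i] suc pos by (auto simp: frozen_def)
qed

text \<open>Each operation changes the number of parts, so performing one never returns the same
  list.\<close>

lemma iota_eq_iff: "iota r m \<pi> = \<pi> \<longleftrightarrow> (\<forall>i. \<not> can_split m \<pi> i \<and> \<not> can_merge r m \<pi> i)"
proof (cases "\<exists>i. can_split m \<pi> i \<or> can_merge r m \<pi> i")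
  case True
  define i where "i = (LEAST i. can_split m \<pi> i \<or> can_merge r m \<pi> i)"
  have i: "can_split m \<pi> i \<or> can_merge r m \<pi> i"
    unfolding i_def using True by (rule LeastI_ex)
  have "iota r m \<pi> = (if can_split m \<pi> i then split_at r \<pi> i else merge_at \<pi> i)"
    using True by (simp add: iota_def i_def Let_def)
  moreover have "length (split_at r \<pi> i) \<noteq> length \<pi>" if "can_split m \<pi> i"
    using that by (simp add: can_split_def split_at_def)
  moreover have "length (merge_at \<pi> i) \<noteq> length \<pi>" if "can_merge r m \<pi> i"
    using that by (auto simp: can_merge_def merge_at_def)
  ultimately have "length (iota r m \<pi>) \<noteq> length \<pi>" using i by auto
  then show ?thesis using True by auto
qed (auto simp: iota_def)

lemma iota_eq_iff_flip:
  assumes "m \<le> (\<Sum>B\<leftarrow>\<pi>. card B)" "\<And>B. B \<in> set \<pi> \<Longrightarrow> 0 < card B"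
  shows "iota r m \<pi> = \<pi> \<longleftrightarrow> flip r m 0 \<pi> = \<pi>"
proof -
  have "can_split m \<pi> i \<longleftrightarrow> i < length \<pi> \<and> splittable m (prefix_size \<pi> i) (\<pi> ! i)" for i
    using frozen_iff[OF assms] by (auto simp: can_split_def splittable_def)
  moreover have "can_merge r m \<pi> i \<longleftrightarrow>
      i < length \<pi> \<and> mergeable r m (prefix_size \<pi> i) (\<pi> ! i) (drop (Suc i) \<pi>)" for i
  proof (cases "Suc i < length \<pi>")
    case True
    then show ?thesis
      using frozen_merge_iff[OF assms True]
      by (auto simp: can_merge_def Cons_nth_drop_Suc[symmetric])
  qed (simp add: can_merge_def)
  ultimately show ?thesis by (auto simp: iota_eq_iff flip_eq_iff)
qed

theorem theorem3p15:
  fixes \<M> :: "mclass set"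
    and S :: "(mclass \<Rightarrow>\<^sub>0 'k::field) \<Rightarrow> (mclass \<Rightarrow>\<^sub>0 'k)"
    and E :: "'a set"
    and r :: "('a \<times> 'a) set"
    and m :: nat
  assumes "minor_sum_closed \<M>"
    and "contains_uniform \<M>"
    and "is_antipode \<M> S"
    and "finite E"
    and "m \<le> card E"
    and "linear_order_on E r"
  shows "S \<langle>uniform_matroid m E\<rangle> =
    (\<Sum>\<pi> | \<pi> \<in> ordered_set_partitions E \<and> iota r m \<pi> = \<pi>.
       osp_sgn \<pi> *
       (let I = initial_part m \<pi>; L = crit_part m \<pi>
        in \<langle>uniform_matroid (card I) I \<oplus> uniform_matroid (m - card I) L
            \<oplus> uniform_matroid 0 (E - (I \<union> L))\<rangle>))"
proof -
  have "S \<langle>uniform_matroid m E\<rangle> = (\<Sum>\<pi> | osp_on E \<pi>. takeuchi_term m \<pi>)"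
    by (rule antipode_uniform_takeuchi[OF assms(2-4)])
  also have "\<dots> = (\<Sum>\<pi> | osp_on E \<pi> \<and> flip r m 0 \<pi> = \<pi>. takeuchi_term m \<pi>)"
    by (rule sum_takeuchi_term_fixed[OF assms(6,4)])
  \<comment> \<open>Parts of an ordered set partition of the finite set \<open>E\<close> have
    positive sizes with sum \<open>card E\<close>, so the comparison of fixed points
    applies.\<close>
  also have "{\<pi>. osp_on E \<pi> \<and> flip r m 0 \<pi> = \<pi>} =
      {\<pi> \<in> ordered_set_partitions E. iota r m \<pi> = \<pi>}"
    using iota_eq_iff_flip osp_on_sum_card osp_on_card_pos assms(4,5)
    by (metis (mono_tags, lifting) osp_on_iff)
  also have "(\<Sum>\<pi> | \<pi> \<in> ordered_set_partitions E \<and> iota r m \<pi> = \<pi>. takeuchi_term m \<pi>) =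
      (\<Sum>\<pi> | \<pi> \<in> ordered_set_partitions E \<and> iota r m \<pi> = \<pi>.
       (osp_sgn \<pi> :: mclass \<Rightarrow>\<^sub>0 'k) *
       (let I = initial_part m \<pi>; L = crit_part m \<pi>
        in \<langle>uniform_matroid (card I) I \<oplus> uniform_matroid (m - card I) L
            \<oplus> uniform_matroid 0 (E - (I \<union> L))\<rangle>))"
    using takeuchi_term_eq[OF _ assms(4,5)] by (intro sum.cong) (auto simp: osp_on_iff)
  finally show ?thesis .
qed

end
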